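(* Let $\Omega\subset\mathbb{R}^n$ be a bounded $\mu$-measurable set, where $\mu$ is a lower Ahlfors $\beta$-regular measure in $\Omega$, let $0\le\alpha<\beta$, and let $p$ be a log-Hölder continuous exponent on $\Omega$ such that $1<p_*\le p(x)\le p^*<\beta/\alpha$ for all $x\in\Omega$. Define $q$ and $s$ on $\Omega$ by $$\frac1{q(x)}=\frac1{p(x)}-\frac{\alpha}{\beta},\qquad s(x)=1+\frac{q(x)}{p'(x)}.$$ Let $r\in(1,s^* )$. Let $w$ be a weight on $\Omega$ such that $w(\cdot)^{q(\cdot)}\in A_{r-\delta}(\Omega)$ for some $\delta\in(0,r-1]$, and such that $$\int_{\Omega\setminus\Omega^{s}_{r,\epsilon_0}}w(x)^{-p'(x)}\,d\mu(x)<\infty$$ for some $\epsilon_0>0$. Then for every $\epsilon$ with $0<\epsilon\le\epsilon_0$ there exists a positive constant $C=C(\epsilon)$ such that $$\|w\,M_\alpha f\|_{q(\cdot),\Omega^{s}_{r,\epsilon}}\le C\,\|w f\|_{p(\cdot),\Omega}$$ for every function $f$ such that $wf\in L^{p(\cdot)}(\Omega)$.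
   Context: $\mu$ is a non-negative Borel regular measure on $\mathbb{R}^n$. $Q=Q(x,l(Q))$ denotes a cube centered at $x$ with side length $l(Q)$ and sides parallel to the coordinate axes; $B(x,\epsilon)$ is the Euclidean ball. The measure $\mu$ is lower Ahlfors $\beta$-regular in the bounded set $\Omega$ ($\beta>0$ a constant) if there is $c>0$ with $\mu(Q(x,l(Q)))\ge c\,l(Q)^{\beta}$ for every $x\in\Omega$ and every cube $Q=Q(x,l(Q))$ with $0<l(Q)<\mathrm{diam}(\Omega)$. An exponent is a $\mu$-measurable function $p:\Omega\to[1,\infty)$. For a function $t$ on $\Omega$ write $t_*=\inf_\Omega t$, $t^*=\sup_\Omega t$. When $p_*>1$, $p'$ is defined by $1/p(x)+1/p'(x)=1$. An exponent $p$ is log-Hölder continuous if there is $C>0$ with $|p(x)-p(y)|\le C/\log(1/|x-y|)$ for all $x,y\in\Omega$ with $|x-y|\le 1/2$. When $\alpha=0$, $\beta/\alpha$ means $\infty$. For $\mu$-measurable $f$ and a measurable set $E\subset\Omega$, $\rho_{p(\cdot),E}(f)=\int_E|f(x)|^{p(x)}\,d\mu(x)$ and $\|f\|_{p(\cdot),E}=\inf\{\lambda>0:\rho_{p(\cdot),E}(f/\lambda)\le1\}$. $L^{p(\cdot)}(\Omega)$ is the set of $\mu$-measurable $f$ supported in $\Omega$ with $\|f\|_{p(\cdot),\Omega}<\infty$. Functions on $\Omega$ are extended by $0$ outside $\Omega$. The centered fractional maximal function is $$M_\alpha f(x)=\sup_{\rho>0}\frac{1}{\mu(Q(x,\rho))^{1-\alpha/\beta}}\int_{Q(x,\rho)}|f(y)|\,d\mu(y).$$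 A weight on $\Omega$ is a $\mu$-measurable function $w$ with $0<w<\infty$ $\mu$-a.e. For $1<\sigma<\infty$, a weight $v$ belongs to $A_\sigma(\Omega)$ if there is $C>0$ with $$\Big(\frac1{\mu(Q)}\int_{Q\cap\Omega}v\,d\mu\Big)\Big(\frac1{\mu(Q)}\int_{Q\cap\Omega}v^{-1/(\sigma-1)}\,d\mu\Big)^{\sigma-1}\le C$$ for each cube $Q$ centered at a point of $\Omega$. $v\in A_1(\Omega)$ means that there is $C>0$ with $\frac1{\mu(Q)}\int_{Q\cap\Omega}v\,d\mu\le C\,v(x)$ for $\mu$-a.e. $x\in Q\cap\Omega$ and each cube $Q$ centered at a point of $\Omega$. For a continuous function $t$ on $\Omega$, $r\in\mathbb{R}$ and $\epsilon>0$, put $\Omega_r^t=\{x\in\Omega:t(x)>r\}$ and $\Omega_{r,\epsilon}^t=\Omega_r^t\setminus\bigcup_{x\in\Omega\setminus\Omega_r^t}B(x,\epsilon)$.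
   Formalization: The formal theorem additionally assumes that μ(Q) is finite for every cube Q centered at a point of Ω; otherwise the averages over Q are undefined, and with the convention 1/∞ = 0 the claim fails. *)

theory Defs
  imports "HOL-Analysis.Analysis"
begin

text \<open>The measure is given on its \<open>\<sigma>\<close>-algebra of measurable sets: complete (as for the measurable
  sets of an outer measure), containing the Borel sets, with every measurable set contained in a
  Borel set of the same measure.\<close>

definition borel_regular :: "(real ^ 'n) measure \<Rightarrow> bool" where
  "borel_regular \<mu> \<longleftrightarrow>
     space \<mu> = UNIV \<and> sets borel \<subseteq> sets \<mu> \<and> complete_measure \<mu> \<and>
     (\<forall>A\<in>sets \<mu>. \<exists>B\<in>sets borel. A \<subseteq> B \<and> emeasure \<mu> B = emeasure \<mu> A)"

text \<open>Center \<open>x\<close> and side length \<open>l\<close> (so half-width \<open>l / 2\<close>); cubes are taken closed.\<close>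

definition cube :: "real ^ 'n \<Rightarrow> real \<Rightarrow> (real ^ 'n) set" where
  "cube x l = {y. \<forall>i. \<bar>y $ i - x $ i\<bar> \<le> l / 2}"

definition lower_ahlfors_regular :: "(real ^ 'n) measure \<Rightarrow> real \<Rightarrow> (real ^ 'n) set \<Rightarrow> bool" where
  "lower_ahlfors_regular \<mu> \<beta> \<Omega> \<longleftrightarrow>
     (\<exists>c>0. \<forall>x\<in>\<Omega>. \<forall>l. 0 < l \<and> l < diameter \<Omega> \<longrightarrow>
        ennreal (c * l powr \<beta>) \<le> emeasure \<mu> (cube x l))"

text \<open>Real powers on \<open>[0, \<infinity>]\<close>, with \<open>0 powr a = \<infinity>\<close> and \<open>\<infinity> powr a = 0\<close> for \<open>a < 0\<close>.\<close>

definition epowr :: "ennreal \<Rightarrow> real \<Rightarrow> ennreal" (infixr "epowr" 80) where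
  "x epowr a =
     (if a = 0 then 1
      else if x = 0 then (if a > 0 then 0 else \<infinity>)
      else if x = \<infinity> then (if a > 0 then \<infinity> else 0)
      else ennreal (enn2real x powr a))"

text \<open>Functions on \<open>\<Omega>\<close> are total functions of which only the values on \<open>\<Omega>\<close> are used.\<close>

definition exponent :: "(real ^ 'n) measure \<Rightarrow> (real ^ 'n) set \<Rightarrow> (real ^ 'n \<Rightarrow> real) \<Rightarrow> bool" where
  "exponent \<mu> \<Omega> p \<longleftrightarrow> p \<in> borel_measurable (restrict_space \<mu> \<Omega>) \<and> (\<forall>x\<in>\<Omega>. 1 \<le> p x)"

text \<open>For \<open>x = y\<close> the bound reads \<open>0 \<le> 0\<close>, since \<open>ln (1 / 0) = 0\<close>.\<close>

definition log_Holder_continuous :: "(real ^ 'n) set \<Rightarrow> (real ^ 'n \<Rightarrow> real) \<Rightarrow> bool" where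
  "log_Holder_continuous \<Omega> p \<longleftrightarrow>
     (\<exists>C>0. \<forall>x\<in>\<Omega>. \<forall>y\<in>\<Omega>. dist x y \<le> 1 / 2 \<longrightarrow> \<bar>p x - p y\<bar> \<le> C / ln (1 / dist x y))"

definition modular ::
  "(real ^ 'n) measure \<Rightarrow> (real ^ 'n \<Rightarrow> real) \<Rightarrow> (real ^ 'n) set \<Rightarrow> (real ^ 'n \<Rightarrow> ereal) \<Rightarrow> ennreal" where
  "modular \<mu> p E f = (\<integral>\<^sup>+x\<in>E. (e2ennreal \<bar>f x\<bar>) epowr (p x) \<partial>\<mu>)"

definition lux_norm ::
  "(real ^ 'n) measure \<Rightarrow> (real ^ 'n \<Rightarrow> real) \<Rightarrow> (real ^ 'n) set \<Rightarrow> (real ^ 'n \<Rightarrow> ereal) \<Rightarrow> ennreal" where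
  "lux_norm \<mu> p E f =
     Inf {ennreal t | t. t > 0 \<and> modular \<mu> p E (\<lambda>x. f x / ereal t) \<le> 1}"

definition Lp ::
  "(real ^ 'n) measure \<Rightarrow> (real ^ 'n \<Rightarrow> real) \<Rightarrow> (real ^ 'n) set \<Rightarrow> (real ^ 'n \<Rightarrow> ereal) set" where
  "Lp \<mu> p \<Omega> =
     {f. f \<in> borel_measurable \<mu> \<and> (\<forall>x. x \<notin> \<Omega> \<longrightarrow> f x = 0) \<and> lux_norm \<mu> p \<Omega> f < \<infinity>}"

definition frac_maximal ::
  "(real ^ 'n) measure \<Rightarrow> real \<Rightarrow> real \<Rightarrow> (real ^ 'n \<Rightarrow> ereal) \<Rightarrow> real ^ 'n \<Rightarrow> ennreal" where
  "frac_maximal \<mu> \<beta> \<alpha> f x =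
     (SUP \<rho>\<in>{0<..}. (\<integral>\<^sup>+y\<in>cube x \<rho>. e2ennreal \<bar>f y\<bar> \<partial>\<mu>) /
                      (emeasure \<mu> (cube x \<rho>)) epowr (1 - \<alpha> / \<beta>))"

definition weight :: "(real ^ 'n) measure \<Rightarrow> (real ^ 'n) set \<Rightarrow> (real ^ 'n \<Rightarrow> ennreal) \<Rightarrow> bool" where
  "weight \<mu> \<Omega> w \<longleftrightarrow>
     w \<in> borel_measurable (restrict_space \<mu> \<Omega>) \<and> (AE x in \<mu>. x \<in> \<Omega> \<longrightarrow> 0 < w x \<and> w x < \<infinity>)"

text \<open>The class \<open>A\<^sub>\<sigma>(\<Omega>)\<close>, for \<open>1 \<le> \<sigma> < \<infinity>\<close>.\<close>

definition muckenhoupt ::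
  "(real ^ 'n) measure \<Rightarrow> (real ^ 'n) set \<Rightarrow> real \<Rightarrow> (real ^ 'n \<Rightarrow> ennreal) \<Rightarrow> bool" where
  "muckenhoupt \<mu> \<Omega> \<sigma> v \<longleftrightarrow> weight \<mu> \<Omega> v \<and>
     (if \<sigma> = 1 then
        \<exists>C::real. C > 0 \<and> (\<forall>z\<in>\<Omega>. \<forall>l>0. AE x in \<mu>. x \<in> cube z l \<inter> \<Omega> \<longrightarrow>
          (\<integral>\<^sup>+y\<in>cube z l \<inter> \<Omega>. v y \<partial>\<mu>) / emeasure \<mu> (cube z l) \<le> ennreal C * v x)
      else
        \<exists>C::real. C > 0 \<and> (\<forall>z\<in>\<Omega>. \<forall>l>0.
          ((\<integral>\<^sup>+y\<in>cube z l \<inter> \<Omega>. v y \<partial>\<mu>) / emeasure \<mu> (cube z l)) *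
          ((\<integral>\<^sup>+y\<in>cube z l \<inter> \<Omega>. (v y) epowr (- 1 / (\<sigma> - 1)) \<partial>\<mu>) / emeasure \<mu> (cube z l))
             epowr (\<sigma> - 1) \<le> ennreal C))"

definition superlevel :: "(real ^ 'n) set \<Rightarrow> (real ^ 'n \<Rightarrow> real) \<Rightarrow> real \<Rightarrow> (real ^ 'n) set" where
  "superlevel \<Omega> t r = {x\<in>\<Omega>. t x > r}"

definition inner_superlevel ::
  "(real ^ 'n) set \<Rightarrow> (real ^ 'n \<Rightarrow> real) \<Rightarrow> real \<Rightarrow> real \<Rightarrow> (real ^ 'n) set" where
  "inner_superlevel \<Omega> t r \<epsilon> = superlevel \<Omega> t r - (\<Union>x\<in>\<Omega> - superlevel \<Omega> t r. ball x \<epsilon>)"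

end

theory Submission
  imports Defs
begin

text \<open>
  Put \<open>a = \<alpha> / \<beta>\<close>, \<open>v = w\<^sup>q\<close>, \<open>\<sigma> = r - \<delta>\<close> and let \<open>\<nu>\<close> be the measure with density \<open>v\<close> on \<open>\<Omega>\<close>. Three
  reductions turn the claim into the maximal theorem for \<open>\<nu>\<close>.

  First, the fractional order disappears. Since \<open>s = (1 - a) q\<close>, a function with \<open>P = \<bar>w f\<bar>\<^sup>p\<close> of
  integral at most \<open>1\<close> factors as \<open>\<bar>f\<bar> = g\<^bsup>1-a\<^esup> P\<^sup>a\<close> with \<open>g = (P / v)\<^bsup>1/s\<^esup>\<close>, on all of \<open>\<Omega>\<close> with the same
  constant powers. Hoelder's inequality on a cube \<open>Q\<close> then gives
  \<open>(\<mu>(Q)\<^bsup>a-1\<^esup> \<integral>\<^sub>Q \<bar>f\<bar>)\<^sup>q \<le> T\<^sup>s\<close>, where \<open>T\<close> is the average of \<open>g\<close> over \<open>Q\<close>.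

  Second, the variable exponent is made constant (\<open>large_average\<close>). The function \<open>g\<close> is integrable, because
  \<open>w\<^bsup>-p'\<^esup>\<close> is: near the part of \<open>\<Omega>\<close> where \<open>s \<le> r\<close> this is the hypothesis, and elsewhere it follows from the
  Muckenhoupt condition, as \<open>w\<^bsup>-p'\<^esup> = v\<^bsup>-1/(s-1)\<^esup>\<close>. By lower regularity the averages over cubes whose side
  is bounded below are therefore bounded, and for small sides \<open>l\<close> they are at most a multiple of
  \<open>l\<^bsup>-\<beta>\<^esup>\<close>, which log-Hoelder continuity absorbs: for \<open>T \<ge> 1\<close> the powers
  \<open>T\<^bsup>s(x)\<^esup>\<close> and \<open>T\<^bsup>s(y)\<^esup>\<close> are comparable on \<open>Q\<close>. A small cube
  around a point of the inner superlevel set sees only points of \<open>\<Omega>\<close> with \<open>s > r\<close>, so \<open>T\<^bsup>s/r\<^esup>\<close>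
  is controlled by the average of \<open>h = (P / v)\<^bsup>1/r\<^esup>\<close>, a function with a constant exponent.

  Third, the condition \<open>v \<in> A\<^sub>\<sigma>\<close> replaces the average of \<open>h\<close> with respect to \<open>\<mu>\<close> by the
  average of \<open>h\<^sup>\<sigma>\<close> with respect to \<open>\<nu>\<close> (\<open>muckenhoupt_average\<close>). It remains to bound the centred
  maximal function of \<open>\<nu>\<close> on the space of exponent \<open>r / \<sigma> > 1\<close>; this is where the loss \<open>\<delta>\<close> enters. As \<open>\<nu>\<close>
  need not be doubling, the weak-type inequality comes from the Besicovitch covering lemma for cubes
  (\<open>besicovitch_selection\<close> and \<open>selection_overlap\<close>), and the
  strong one from it by interpolation with the trivial bound (\<open>maximal_strong_type\<close>).

  The measurability of the maximal function is left open: its integral is the supremum of the integrals of the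
  simple functions below it, and the estimates are proved for those. Likewise the covering
  lemma is only needed for cubes whose sides are bounded below, where finitely many cubes suffice; a
  limit inferior of finite covers handles the rest.
\<close>

section \<open>The Besicovitch covering lemma for cubes\<close>

lemma cube_closed: "closed (cube x l)"
proof -
  have "cube x l = (\<Inter>i. {y. \<bar>y $ i - x $ i\<bar> \<le> l / 2})"
    by (auto simp: cube_def)
  also have "closed \<dots>"
    by (intro closed_INT ballI closed_Collect_le continuous_intros)
  finally show ?thesis .
qed

lemma cube_mono: "l \<le> l' \<Longrightarrow> cube x l \<subseteq> cube x l'"
  unfolding cube_def by (fastforce intro: order_trans)

lemma center_in_cube: "0 \<le> l \<Longrightarrow> x \<in> cube x l"
  by (simp add: cube_def)

lemma dist_in_cube_le:
  fixes x y :: "real ^ 'n"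
  assumes "y \<in> cube x l"
  shows "dist x y \<le> real CARD('n) * l / 2"
proof -
  have "dist x y = norm (y - x)" by (simp add: dist_norm norm_minus_commute)
  also have "\<dots> \<le> (\<Sum>i\<in>UNIV. \<bar>(y - x) $ i\<bar>)" by (rule norm_le_l1_cart)
  also have "\<dots> \<le> (\<Sum>i\<in>(UNIV::'n set). l / 2)"
    using assms by (intro sum_mono) (simp add: cube_def)
  finally show ?thesis by simp
qed

lemma ball_subset_cube:
  assumes "y \<in> ball z (l/4)" "x \<in> ball z (l/4)"
  shows "y \<in> cube x l"
  unfolding cube_def
proof safe
  fix i
  have "dist y x \<le> dist z y + dist z x"
    by (metis dist_commute dist_triangle)
  then have "dist y x \<le> l/2" using assms by simp
  moreover have "\<bar>y $ i - x $ i\<bar> \<le> dist y x"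
    using component_le_norm_cart[of "y - x" i] by (simp add: dist_norm)
  ultimately show "\<bar>y $ i - x $ i\<bar> \<le> l / 2" by simp
qed

text \<open>
  Greedy choice: take a cube whose side is at least half the supremum, discard the centers that it
  covers, repeat. Small balls \<open>ball k (\<eta> / 4)\<close> with \<open>k \<in> K\<close> measure the progress, since a chosen cube swallows
  every center in the small ball that contains its own center. The alternative in the conclusion records, without naming the
  order of choice, that the earlier cube misses the later center and is not much smaller.
\<close>

lemma besicovitch_selection_aux:
  fixes A :: "(real ^ 'n) set"
  assumes "finite K" "A \<subseteq> (\<Union>k\<in>K. ball k (\<eta>/4))"
    and "0 < \<eta>" "\<And>x. x \<in> A \<Longrightarrow> \<eta> \<le> l x \<and> l x \<le> R"
  shows "\<exists>F\<subseteq>A. finite F \<and> A \<subseteq> (\<Union>x\<in>F. cube x (l x)) \<and>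
    (\<forall>x\<in>F. \<forall>y\<in>F. x \<noteq> y \<longrightarrow> (y \<notin> cube x (l x) \<and> l y \<le> 2 * l x) \<or> (x \<notin> cube y (l y) \<and> l x \<le> 2 * l y))"
  using assms
proof (induction "card K" arbitrary: K A)
  case 0
  then have "A = {}" by auto
  then show ?case by auto
next
  case (Suc n)
  show ?case
  proof (cases "A = {}")
    case False
    have bd: "bdd_above (l ` A)" using Suc.prems(4) by (auto intro!: bdd_aboveI)
    from False obtain x0 where x0: "x0 \<in> A" by auto
    define S where "S = Sup (l ` A)"
    have S0: "0 < S"
      using cSup_upper[of "l x0" "l ` A"] x0 bd Suc.prems(3) Suc.prems(4)[of x0] by (auto simp: S_def)
    obtain x where x: "x \<in> A" "S / 2 < l x"
      using less_cSup_iff[of "l ` A" "S/2"] bd False S0 by (auto simp: S_def)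
    have big: "l y \<le> 2 * l x" if "y \<in> A" for y
    proof -
      have "l y \<le> S" unfolding S_def by (intro cSup_upper) (use that bd in auto)
      then show ?thesis using x by simp
    qed
    obtain k where k: "k \<in> K" "x \<in> ball k (\<eta>/4)" using x Suc.prems(2) by auto
    define A' where "A' = A - cube x (l x)"
    have cov: "A' \<subseteq> (\<Union>k\<in>K - {k}. ball k (\<eta>/4))"
    proof
      fix y assume y: "y \<in> A'"
      then obtain k' where k': "k' \<in> K" "y \<in> ball k' (\<eta>/4)" using Suc.prems(2) by (auto simp: A'_def)
      have "k' \<noteq> k"
      proof
        assume "k' = k"
        then have "y \<in> cube x \<eta>" using k k' ball_subset_cube by blast
        then have "y \<in> cube x (l x)" using cube_mono Suc.prems(4) x by blast
        then show False using y by (simp add: A'_def)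
      qed
      then show "y \<in> (\<Union>k\<in>K - {k}. ball k (\<eta>/4))" using k' by blast
    qed
    have "n = card (K - {k})" using Suc.hyps(2) k Suc.prems(1) by simp
    moreover have "finite (K - {k})" using Suc.prems(1) by simp
    moreover have "\<eta> \<le> l y \<and> l y \<le> R" if "y \<in> A'" for y
      using that Suc.prems(4) by (simp add: A'_def)
    ultimately obtain F where F: "F \<subseteq> A'" "finite F"
      "A' \<subseteq> (\<Union>x\<in>F. cube x (l x))"
      "\<forall>x\<in>F. \<forall>y\<in>F. x \<noteq> y \<longrightarrow> (y \<notin> cube x (l x) \<and> l y \<le> 2 * l x) \<or> (x \<notin> cube y (l y) \<and> l x \<le> 2 * l y)"
      using Suc.hyps(1)[OF _ _ cov Suc.prems(3)] by blast
    have F': "y \<notin> cube x (l x) \<and> l y \<le> 2 * l x" if "y \<in> F" for y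
      using that F(1) big by (auto simp: A'_def)
    show ?thesis
    proof (intro exI[of _ "insert x F"] conjI)
      show "insert x F \<subseteq> A" using F x by (auto simp: A'_def)
      show "A \<subseteq> (\<Union>x\<in>insert x F. cube x (l x))" using F(3) by (auto simp: A'_def)
      show "\<forall>xa\<in>insert x F. \<forall>y\<in>insert x F.
       xa \<noteq> y \<longrightarrow> y \<notin> cube xa (l xa) \<and> l y \<le> 2 * l xa \<or> xa \<notin> cube y (l y) \<and> l xa \<le> 2 * l y"
        using F(4) F' by blast
    qed (use F in auto)
  qed auto
qed

lemma besicovitch_selection:
  fixes A :: "(real ^ 'n) set"
  assumes "bounded A" "0 < \<eta>" "\<And>x. x \<in> A \<Longrightarrow> \<eta> \<le> l x \<and> l x \<le> R"
  obtains F where "F \<subseteq> A" "finite F" "A \<subseteq> (\<Union>x\<in>F. cube x (l x))"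
    "\<And>x y. x \<in> F \<Longrightarrow> y \<in> F \<Longrightarrow> x \<noteq> y \<Longrightarrow>
       (y \<notin> cube x (l x) \<and> l y \<le> 2 * l x) \<or> (x \<notin> cube y (l y) \<and> l x \<le> 2 * l y)"
proof -
  have "compact (closure A)" using assms(1) by (simp add: compact_closure)
  then obtain K where "finite K" "closure A \<subseteq> (\<Union>k\<in>K. ball k (\<eta>/4))"
    using compact_imp_seq_compact seq_compact_imp_totally_bounded assms(2)
    by (metis divide_pos_pos zero_less_numeral)
  then have "A \<subseteq> (\<Union>k\<in>K. ball k (\<eta>/4))" using closure_subset by blast
  from besicovitch_selection_aux[OF \<open>finite K\<close> this assms(2), of l R] obtain F where
    "F \<subseteq> A" "finite F" "A \<subseteq> (\<Union>x\<in>F. cube x (l x))"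
    "\<forall>x\<in>F. \<forall>y\<in>F. x \<noteq> y \<longrightarrow> (y \<notin> cube x (l x) \<and> l y \<le> 2 * l x) \<or> (x \<notin> cube y (l y) \<and> l x \<le> 2 * l y)"
    using assms(3) by auto
  then show ?thesis by (intro that) blast+
qed

text \<open>
  Sort the cubes containing \<open>z\<close> by the orthant, as seen from \<open>z\<close>, in which their centers lie. Two centers in
  the same orthant differ in each coordinate by at most half the larger side, so of two such cubes the one
  chosen first must be the smaller one, and hence all sides in an orthant agree up to the factor
  \<open>2\<close>. With \<open>m\<close> the smallest of them, the coordinates of the centers lie within \<open>m\<close> of those
  of \<open>z\<close>; halving this range cuts the orthant into cells of width \<open>m / 2\<close>, and each cell contains at
  most one center.
\<close>

lemma selection_overlap:
  fixes F :: "(real ^ 'n) set"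
  assumes "finite F"
    and sep: "\<And>x y. x \<in> F \<Longrightarrow> y \<in> F \<Longrightarrow> x \<noteq> y \<Longrightarrow>
       (y \<notin> cube x (l x) \<and> l y \<le> 2 * l x) \<or> (x \<notin> cube y (l y) \<and> l x \<le> 2 * l y)"
  shows "card {x\<in>F. z \<in> cube x (l x)} \<le> CARD('n \<Rightarrow> bool \<times> bool)"
proof -
  define G where "G = {x\<in>F. z \<in> cube x (l x)}"
  define sg :: "real ^ 'n \<Rightarrow> 'n \<Rightarrow> bool" where "sg x = (\<lambda>i. z $ i \<le> x $ i)" for x
  define m where "m \<sigma> = Min (l ` {x\<in>G. sg x = \<sigma>})" for \<sigma>
  define c :: "real ^ 'n \<Rightarrow> 'n \<Rightarrow> bool \<times> bool"
    where "c x = (\<lambda>i. (sg x i, m (sg x) / 2 < \<bar>x $ i - z $ i\<bar>))" for x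
  have finG: "finite G" using assms(1) by (simp add: G_def)
  have inG: "\<bar>x $ i - z $ i\<bar> \<le> l x / 2" if "x \<in> G" for x i
    using that by (auto simp: G_def cube_def abs_minus_commute)
  have comparable: "l y \<le> 2 * l x" and close: "\<bar>x $ i - y $ i\<bar> \<le> max (l x) (l y) / 2"
    if "x \<in> G" "y \<in> G" "sg x = sg y" for x y i
  proof -
    have sgeq: "z $ i \<le> x $ i \<longleftrightarrow> z $ i \<le> y $ i" for i
      using that(3) by (metis sg_def)
    have cl: "\<bar>x $ i - y $ i\<bar> \<le> max (l x) (l y) / 2" for i
      using inG[OF that(1), of i] inG[OF that(2), of i] sgeq[of i] by (auto simp: abs_if max_def split: if_splits)
    show "\<bar>x $ i - y $ i\<bar> \<le> max (l x) (l y) / 2" by (rule cl)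
    have pos: "0 \<le> l x" using inG[OF that(1), of undefined] abs_ge_zero[of "x $ undefined - z $ undefined"] by linarith
    show "l y \<le> 2 * l x"
    proof (cases "x = y")
      case False
      then consider "y \<notin> cube x (l x) \<and> l y \<le> 2 * l x" | "x \<notin> cube y (l y)"
        using sep[of x y] False \<open>x \<in> G\<close> \<open>y \<in> G\<close> by (auto simp: G_def)
      then show ?thesis
      proof cases
        case 2
        then have "\<not> (\<forall>i. \<bar>x $ i - y $ i\<bar> \<le> l y / 2)" by (simp add: cube_def)
        then obtain i where "l y / 2 < \<bar>x $ i - y $ i\<bar>" by (meson not_le)
        then have "l y < l x" using cl[of i] by (simp add: max_def split: if_splits)
        then show ?thesis using pos by simp
      qed simp
    qed (use pos in simp)
  qed
  have "inj_on c G"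
  proof (rule inj_onI, rule ccontr)
    fix x y assume xy: "x \<in> G" "y \<in> G" "c x = c y" "x \<noteq> y"
    have sgeq: "sg x = sg y" using fun_cong[OF xy(3)] by (auto simp: c_def)
    define m0 where "m0 = m (sg x)"
    have m0_le: "m0 \<le> l x'" if "x' \<in> G" "sg x' = sg x" for x'
      unfolding m0_def m_def using that finG by (intro Min_le) auto
    have "m0 \<in> l ` {x'\<in>G. sg x' = sg x}"
      unfolding m0_def m_def using xy finG by (intro Min_in) auto
    then obtain x' where x': "x' \<in> G" "sg x' = sg x" "m0 = l x'" by auto
    have far: "l x \<le> 2 * m0" "l y \<le> 2 * m0"
      using comparable[OF x'(1) xy(1)] comparable[OF x'(1) xy(2)] x' sgeq by auto
    \<comment> \<open>The second component of \<open>c\<close> says in which half of the range \<open>[0, m0]\<close> the distance to \<open>z\<close> lies.\<close>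
    have "\<bar>x $ i - y $ i\<bar> \<le> m0 / 2" for i
    proof -
      have "z $ i \<le> x $ i \<longleftrightarrow> z $ i \<le> y $ i" using sgeq by (metis sg_def)
      moreover have "m0 / 2 < \<bar>x $ i - z $ i\<bar> \<longleftrightarrow> m0 / 2 < \<bar>y $ i - z $ i\<bar>"
        using fun_cong[OF xy(3), of i] sgeq by (auto simp: c_def m0_def)
      ultimately show ?thesis
        using inG[OF xy(1), of i] inG[OF xy(2), of i] far by (auto simp: abs_if split: if_splits)
    qed
    then have "y \<in> cube x (l x)" "x \<in> cube y (l y)"
      using m0_le[OF xy(1)] m0_le[OF xy(2)] sgeq
      unfolding cube_def by (auto simp: abs_minus_commute intro: order_trans)
    then show False using sep[of x y] xy by (auto simp: G_def)
  qed
  then have "card G \<le> CARD('n \<Rightarrow> bool \<times> bool)"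
    by (intro card_inj_on_le[of c]) auto
  then show ?thesis by (simp add: G_def)
qed

section \<open>The centred maximal function of an arbitrary finite measure\<close>

lemma cube_sets: "sets borel \<subseteq> sets \<nu> \<Longrightarrow> cube x l \<in> sets \<nu>"
  using borel_closed[OF cube_closed] by blast

lemma maximal_weak_type_finite_cover:
  fixes \<nu> :: "(real ^ 'n) measure" and G :: "real ^ 'n \<Rightarrow> ennreal" and t :: ennreal
  assumes sets: "sets borel \<subseteq> sets \<nu>" and G[measurable]: "G \<in> borel_measurable \<nu>"
    and A: "bounded A" "0 < \<eta>" "\<And>x. x \<in> A \<Longrightarrow> \<eta> \<le> l x \<and> l x \<le> R"
    and le: "\<And>x. x \<in> A \<Longrightarrow> t * emeasure \<nu> (cube x (l x)) \<le> (\<integral>\<^sup>+y\<in>cube x (l x). G y \<partial>\<nu>)"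
  shows "\<exists>U\<in>sets \<nu>. A \<subseteq> U \<and> t * emeasure \<nu> U \<le> of_nat CARD('n \<Rightarrow> bool \<times> bool) * (\<integral>\<^sup>+y. G y \<partial>\<nu>)"
proof -
  note [measurable] = cube_sets[OF sets]
  obtain F where F: "F \<subseteq> A" "finite F" "A \<subseteq> (\<Union>x\<in>F. cube x (l x))"
    and sep: "\<And>x y. x \<in> F \<Longrightarrow> y \<in> F \<Longrightarrow> x \<noteq> y \<Longrightarrow>
       (y \<notin> cube x (l x) \<and> l y \<le> 2 * l x) \<or> (x \<notin> cube y (l y) \<and> l x \<le> 2 * l y)"
    by (rule besicovitch_selection[OF A(1,2), of l R]) (use A(3) that in auto)
  define U where "U = (\<Union>x\<in>F. cube x (l x))"
  have overlap: "(\<Sum>x\<in>F. G y * indicator (cube x (l x)) y) \<le> of_nat CARD('n \<Rightarrow> bool \<times> bool) * G y" for y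
  proof -
    have "(\<Sum>x\<in>F. G y * indicator (cube x (l x)) y) = G y * (\<Sum>x\<in>F. indicator {x. y \<in> cube x (l x)} x)"
      by (simp add: sum_distrib_left indicator_def)
    also have "(\<Sum>x\<in>F. indicator {x. y \<in> cube x (l x)} x :: ennreal) = of_nat (card {x\<in>F. y \<in> cube x (l x)})"
      using F(2) by (simp add: indicator_def of_bool_def sum.inter_filter[symmetric])
    also have "G y * of_nat (card {x\<in>F. y \<in> cube x (l x)}) \<le> G y * of_nat CARD('n \<Rightarrow> bool \<times> bool)"
      by (intro mult_left_mono of_nat_mono selection_overlap F sep) auto
    finally show ?thesis by (simp add: mult.commute)
  qed
  have "t * emeasure \<nu> U \<le> t * (\<Sum>x\<in>F. emeasure \<nu> (cube x (l x)))"
    unfolding U_def by (intro mult_left_mono emeasure_subadditive_finite F) auto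
  also have "\<dots> \<le> (\<Sum>x\<in>F. \<integral>\<^sup>+y\<in>cube x (l x). G y \<partial>\<nu>)"
    unfolding sum_distrib_left using F(1) by (intro sum_mono le) auto
  also have "\<dots> = (\<integral>\<^sup>+y. (\<Sum>x\<in>F. G y * indicator (cube x (l x)) y) \<partial>\<nu>)"
    by (rule nn_integral_sum[symmetric]) measurable
  also have "\<dots> \<le> (\<integral>\<^sup>+y. of_nat CARD('n \<Rightarrow> bool \<times> bool) * G y \<partial>\<nu>)"
    by (intro nn_integral_mono overlap)
  also have "\<dots> = of_nat CARD('n \<Rightarrow> bool \<times> bool) * (\<integral>\<^sup>+y. G y \<partial>\<nu>)"
    by (rule nn_integral_cmult) measurable
  finally show ?thesis using F(3) by (intro bexI[of _ U]) (auto simp: U_def intro!: sets.finite_UN F(2))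
qed

text \<open>
  The points with a good cube of side at least \<open>1 / (m + 1)\<close> may form a non-measurable set, but they are
  covered by a measurable set \<open>U m\<close> of controlled measure. Every point of \<open>A\<close> belongs to all \<open>U m\<close> from some
  index on, so the limit inferior \<open>\<Union>k. V k\<close> of the \<open>U m\<close> contains \<open>A\<close> and obeys the same bound.
\<close>

lemma maximal_weak_type:
  fixes \<nu> :: "(real ^ 'n) measure" and G :: "real ^ 'n \<Rightarrow> ennreal" and t :: ennreal
  assumes sets: "sets borel \<subseteq> sets \<nu>" and G: "G \<in> borel_measurable \<nu>"
    and A: "bounded A"
    and ex: "\<And>x. x \<in> A \<Longrightarrow> \<exists>l. 0 < l \<and> l \<le> R \<and> t * emeasure \<nu> (cube x l) \<le> (\<integral>\<^sup>+y\<in>cube x l. G y \<partial>\<nu>)"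
  shows "t * emeasure \<nu> A \<le> of_nat CARD('n \<Rightarrow> bool \<times> bool) * (\<integral>\<^sup>+y. G y \<partial>\<nu>)" (is "_ \<le> ?I")
proof -
  obtain l where l: "\<And>x. x \<in> A \<Longrightarrow> 0 < l x \<and> l x \<le> R \<and>
      t * emeasure \<nu> (cube x (l x)) \<le> (\<integral>\<^sup>+y\<in>cube x (l x). G y \<partial>\<nu>)"
    using ex by metis
  define A' where "A' m = {x\<in>A. inverse (real (Suc m)) \<le> l x}" for m
  have "\<exists>U\<in>sets \<nu>. A' m \<subseteq> U \<and> t * emeasure \<nu> U \<le> ?I" for m
  proof (rule maximal_weak_type_finite_cover[OF sets G])
    show "bounded (A' m)" using A by (rule bounded_subset) (auto simp: A'_def)
    show "0 < inverse (real (Suc m))" by simp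
  qed (use l in \<open>auto simp: A'_def\<close>)
  then obtain U where U: "\<And>m. U m \<in> sets \<nu>" "\<And>m. A' m \<subseteq> U m" "\<And>m. t * emeasure \<nu> (U m) \<le> ?I"
    by metis
  define V where "V k = (\<Inter>j. U (k + j))" for k
  have V[measurable]: "V k \<in> sets \<nu>" for k unfolding V_def using U by auto
  have "incseq V"
  proof (rule incseq_SucI)
    fix k show "V k \<le> V (Suc k)" unfolding V_def by (auto, metis add_Suc_right)
  qed
  have "A \<subseteq> (\<Union>k. V k)"
  proof
    fix x assume x: "x \<in> A"
    obtain k where "inverse (real (Suc k)) < l x" using x reals_Archimedean l by blast
    have "x \<in> A' (k + j)" for j
    proof -
      have "inverse (real (Suc (k + j))) \<le> inverse (real (Suc k))" by (intro le_imp_inverse_le) auto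
      also have "\<dots> \<le> l x" using \<open>inverse (real (Suc k)) < l x\<close> by (rule less_imp_le)
      finally show ?thesis using x unfolding A'_def by blast
    qed
    then have "x \<in> V k" using U(2) unfolding V_def by blast
    then show "x \<in> (\<Union>k. V k)" by blast
  qed
  then have "t * emeasure \<nu> A \<le> t * emeasure \<nu> (\<Union>k. V k)"
    by (intro mult_left_mono emeasure_mono) auto
  also have "\<dots> = t * (SUP k. emeasure \<nu> (V k))"
    using SUP_emeasure_incseq[OF image_subsetI[OF V] \<open>incseq V\<close>] by simp
  also have "\<dots> = (SUP k. t * emeasure \<nu> (V k))" by (rule SUP_mult_left_ennreal)
  also have "\<dots> \<le> ?I"
  proof (rule SUP_least)
    fix k
    have "V k \<subseteq> U k" unfolding V_def by (rule INF_lower2[of 0]) simp_all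
    then have "t * emeasure \<nu> (V k) \<le> t * emeasure \<nu> (U k)" using U(1) by (intro mult_left_mono emeasure_mono) auto
    then show "t * emeasure \<nu> (V k) \<le> ?I" using U(3) order_trans by blast
  qed
  finally show ?thesis .
qed

lemma truncated_geometric_sum_le:
  fixes b y :: real
  assumes b: "b = 2 powr e" "0 < e" and y: "0 \<le> y"
  shows "(\<Sum>j<n. b ^ j * of_bool (2 ^ j < y)) \<le> b / (b - 1) * y powr e"
proof -
  have b1: "1 < b" using b by simp
  have S: "(\<Sum>j<n. b ^ j * of_bool (2 ^ j < y)) \<le> (b ^ n - 1) / (b - 1)" for n
  proof -
    have "(\<Sum>j<n. b ^ j * of_bool (2 ^ j < y)) \<le> (\<Sum>j<n. b ^ j)"
      using b1 by (intro sum_mono) auto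
    also have "\<dots> = (b ^ n - 1) / (b - 1)" using b1 by (subst geometric_sum) auto
    finally show ?thesis .
  qed
  show ?thesis
  proof (induction n)
    case 0
    then show ?case using b1 by auto
  next
    case (Suc n)
    show ?case
    proof (cases "2 ^ n < y")
      case True
      have "b ^ n = (2 ^ n) powr e"
        unfolding b(1) by (simp add: powr_powr powr_realpow[symmetric] mult.commute)
      also have "\<dots> \<le> y powr e" using True b by (intro powr_mono2) auto
      finally have *: "b ^ n \<le> y powr e" .
      have "(\<Sum>j<Suc n. b ^ j * of_bool (2 ^ j < y)) \<le> (b ^ Suc n - 1) / (b - 1)" by (rule S)
      also have "\<dots> \<le> b / (b - 1) * b ^ n" using b1 by (simp add: field_simps)
      also have "\<dots> \<le> b / (b - 1) * y powr e" using * b1 by (intro mult_left_mono) auto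
      finally show ?thesis .
    qed (use Suc in simp)
  qed
qed

text \<open>
  The constant of interpolation between the weak type \<open>(1, 1)\<close> with constant \<open>N\<close> and the bound on
  \<open>L\<^sup>\<infinity>\<close>; the last factor is the sum of a geometric series with ratio \<open>2\<^bsup>1-k\<^esup>\<close>.
\<close>

definition strong_type_const :: "nat \<Rightarrow> real \<Rightarrow> real" where
  "strong_type_const N k = real N * 2 powr (2 * k) * (2 powr (k - 1) / (2 powr (k - 1) - 1))"

lemma strong_type_const_nonneg: "1 < k \<Longrightarrow> 0 \<le> strong_type_const N k"
  unfolding strong_type_const_def
  using ge_one_powr_ge_zero[of 2 "k - 1"] by (intro mult_nonneg_nonneg divide_nonneg_nonneg) auto

text \<open>
  Marcinkiewicz interpolation for a function \<open>u\<close> below the centred maximal function of \<open>H\<close>. The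
  hypothesis refers to the levels \<open>t \<ge> 1\<close> alone, at the cost of the total mass on the right: then only the dyadic
  levels \<open>2\<^sup>j\<close> with \<open>j \<ge> 0\<close> occur. At level \<open>t\<close> the part of \<open>H\<close> below \<open>t / 2\<close> contributes at most half
  of the average, so the weak-type inequality can be applied to the part above.
\<close>

lemma maximal_strong_type:
  fixes \<nu> :: "(real ^ 'n) measure" and u H :: "real ^ 'n \<Rightarrow> real"
  assumes sets: "sets borel \<subseteq> sets \<nu>" and fin: "emeasure \<nu> (space \<nu>) < \<infinity>"
    and k: "1 < k"
    and H[measurable]: "H \<in> borel_measurable \<nu>" and H0: "\<And>x. 0 \<le> H x"
    and u[measurable]: "u \<in> borel_measurable \<nu>" and u0: "\<And>x. 0 \<le> u x"
    and B: "bounded B"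
    and ex: "\<And>x t. 1 \<le> t \<Longrightarrow> t < u x \<Longrightarrow> x \<in> B \<and>
      (\<exists>l. 0 < l \<and> l \<le> R \<and> ennreal t * emeasure \<nu> (cube x l) \<le> (\<integral>\<^sup>+y\<in>cube x l. ennreal (H y) \<partial>\<nu>))"
  shows "(\<integral>\<^sup>+x. ennreal (u x powr k) \<partial>\<nu>) \<le> emeasure \<nu> (space \<nu>) +
    ennreal (strong_type_const (CARD('n \<Rightarrow> bool \<times> bool)) k) * (\<integral>\<^sup>+x. ennreal (H x powr k) \<partial>\<nu>)"
proof -
  note [measurable] = cube_sets[OF sets]
  define N where "N = CARD('n \<Rightarrow> bool \<times> bool)"
  define b where "b = 2 powr (k - 1)"
  define A where "A j = {x\<in>space \<nu>. 2 ^ j < u x}" for j :: nat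
  define D where "D j = {x\<in>space \<nu>. 2 ^ j < 2 * H x}" for j :: nat
  have A[measurable]: "A j \<in> sets \<nu>" and D[measurable]: "D j \<in> sets \<nu>" for j
    unfolding A_def D_def by measurable
  have finM: "emeasure \<nu> X < \<infinity>" for X
    using emeasure_space[of \<nu> X] fin by (rule le_less_trans)
  have dyadic: "ennreal (u x powr k) \<le> 1 + (\<Sum>j. ennreal (2 powr (real (j + 1) * k)) * indicator (A j) x)"
    if "x \<in> space \<nu>" for x
  proof (cases "u x \<le> 1")
    case True
    then have "u x powr k \<le> 1" using u0[of x] k by (intro powr_le1) auto
    then have "ennreal (u x powr k) \<le> 1" by (metis ennreal_1 ennreal_leI)
    then show ?thesis by (rule order_trans) simp
  next
    case False
    define j where "j = (LEAST j. u x \<le> 2 ^ Suc j)"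
    have "\<exists>j. u x \<le> 2 ^ Suc j"
    proof -
      obtain i where "u x < 2 ^ i" using real_arch_pow[of 2 "u x"] by auto
      also have "(2::real) ^ i \<le> 2 ^ Suc i" by simp
      finally show ?thesis by (intro exI[of _ i]) simp
    qed
    then have j1: "u x \<le> 2 ^ Suc j" unfolding j_def by (rule LeastI_ex)
    have j2: "2 ^ j < u x"
    proof (cases j)
      case (Suc i)
      then have "\<not> u x \<le> 2 ^ Suc i" using not_less_Least[of i "\<lambda>j. u x \<le> 2 ^ Suc j"] by (simp add: j_def)
      then show ?thesis using Suc by simp
    qed (use False in simp)
    have "u x powr k \<le> (2 ^ Suc j) powr k" using j1 u0 k by (intro powr_mono2) auto
    also have "\<dots> = 2 powr (real (j + 1) * k)" by (simp add: powr_powr powr_realpow[symmetric] del: power_Suc)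
    finally have "ennreal (u x powr k) \<le> ennreal (2 powr (real (j + 1) * k)) * indicator (A j) x"
      using j2 that by (simp add: A_def ennreal_leI)
    also have "\<dots> \<le> (\<Sum>j. ennreal (2 powr (real (j + 1) * k)) * indicator (A j) x)"
      using sum_le_suminf[OF summableI, of "{j}" "\<lambda>j. ennreal (2 powr (real (j + 1) * k)) * indicator (A j) x"]
      by (simp only: sum.insert finite.emptyI empty_iff not_False_eq_True sum.empty add_0_right finite.insertI zero_le)
    finally show ?thesis by (rule order_trans) simp
  qed
  have weak: "emeasure \<nu> (A j) \<le> ennreal (2 / 2 ^ j * real N) * (\<integral>\<^sup>+y. ennreal (H y) * indicator (D j) y \<partial>\<nu>)" for j
  proof -
    have "ennreal (2 ^ j / 2) * emeasure \<nu> (A j) \<le> of_nat N * (\<integral>\<^sup>+y. ennreal (H y) * indicator (D j) y \<partial>\<nu>)"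
      unfolding N_def
    proof (rule maximal_weak_type[OF sets])
      show "bounded (A j)" using B by (rule bounded_subset) (use ex[of "2 ^ j"] in \<open>auto simp: A_def\<close>)
      fix x assume "x \<in> A j"
      then obtain l where l: "0 < l" "l \<le> R"
        "ennreal (2 ^ j) * emeasure \<nu> (cube x l) \<le> (\<integral>\<^sup>+y\<in>cube x l. ennreal (H y) \<partial>\<nu>)"
        using ex[of "2 ^ j" x] by (auto simp: A_def)
      let ?m = "ennreal (2 ^ j / 2) * emeasure \<nu> (cube x l)"
      have fm: "?m < \<infinity>" using finM[of "cube x l"] by (simp add: ennreal_mult_less_top)
      have "?m + ?m = ennreal (2 ^ j) * emeasure \<nu> (cube x l)"
        by (simp add: distrib_right[symmetric] ennreal_plus[symmetric] del: ennreal_plus)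
      also have "\<dots> \<le> (\<integral>\<^sup>+y\<in>cube x l. ennreal (H y) \<partial>\<nu>)" by (rule l)
      also have "\<dots> \<le> (\<integral>\<^sup>+y. ennreal (2 ^ j / 2) * indicator (cube x l) y +
            (ennreal (H y) * indicator (D j) y) * indicator (cube x l) y \<partial>\<nu>)"
        by (intro nn_integral_mono) (auto simp: D_def indicator_def intro!: ennreal_leI)
      also have "\<dots> = ?m + (\<integral>\<^sup>+y\<in>cube x l. (ennreal (H y) * indicator (D j) y) \<partial>\<nu>)"
        by (subst nn_integral_add) (auto simp: nn_integral_cmult_indicator)
      finally have "?m \<le> (\<integral>\<^sup>+y\<in>cube x l. (ennreal (H y) * indicator (D j) y) \<partial>\<nu>)"
        using fm ennreal_add_left_cancel_le[of ?m ?m] by (auto simp del: ennreal_add_left_cancel_le)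
      then show "\<exists>l>0. l \<le> R \<and> ennreal (2 ^ j / 2) * emeasure \<nu> (cube x l)
         \<le> (\<integral>\<^sup>+y\<in>cube x l. (ennreal (H y) * indicator (D j) y) \<partial>\<nu>)"
        using l(1,2) by (intro exI[of _ l]) simp
    qed measurable
    then have "ennreal (2 / 2 ^ j) * (ennreal (2 ^ j / 2) * emeasure \<nu> (A j)) \<le>
        ennreal (2 / 2 ^ j) * (of_nat N * (\<integral>\<^sup>+y. ennreal (H y) * indicator (D j) y \<partial>\<nu>))"
      by (rule mult_left_mono) simp
    then show ?thesis
      by (simp add: mult.assoc[symmetric] ennreal_mult[symmetric] ennreal_of_nat_eq_real_of_nat)
  qed
  have pointwise: "(\<Sum>j. ennreal (2 powr (real (j + 1) * k)) * (ennreal (2 / 2 ^ j * real N) * (ennreal (H x) * indicator (D j) x)))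
      \<le> ennreal (strong_type_const N k) * ennreal (H x powr k)" if "x \<in> space \<nu>" for x
  proof -
    have coef: "2 powr (real (j + 1) * k) * (2 / 2 ^ j) = 2 powr (k + 1) * b ^ j" for j
    proof -
      have "b ^ j = 2 powr ((k - 1) * real j)"
        unfolding b_def by (simp add: powr_realpow[symmetric] powr_powr)
      moreover have "2 / 2 ^ j = 2 powr (1 - real j)" by (simp add: powr_diff powr_realpow)
      ultimately show ?thesis by (simp add: powr_add[symmetric] algebra_simps)
    qed
    have t: "ennreal (2 powr (real (j + 1) * k)) * (ennreal (2 / 2 ^ j * real N) * (ennreal (H x) * indicator (D j) x))
      = ennreal (real N * H x * 2 powr (k + 1) * (b ^ j * of_bool (2 ^ j < 2 * H x)))" for j
    proof (cases "2 ^ j < 2 * H x")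
      case True
      then have "ennreal (2 powr (real (j + 1) * k)) * (ennreal (2 / 2 ^ j * real N) * (ennreal (H x) * indicator (D j) x))
        = ennreal (2 powr (real (j + 1) * k) * (2 / 2 ^ j) * (real N * H x))"
        using that H0[of x] by (simp add: D_def ennreal_mult[symmetric] algebra_simps)
      then show ?thesis unfolding coef using True by (simp add: algebra_simps)
    qed (simp add: D_def)
    have "(\<Sum>j<n. ennreal (real N * H x * 2 powr (k + 1) * (b ^ j * of_bool (2 ^ j < 2 * H x))))
       \<le> ennreal (strong_type_const N k) * ennreal (H x powr k)" for n
    proof -
      have b0: "0 \<le> b" by (simp add: b_def)
      have "(\<Sum>j<n. ennreal (real N * H x * 2 powr (k + 1) * (b ^ j * of_bool (2 ^ j < 2 * H x))))
        = ennreal (\<Sum>j<n. real N * H x * 2 powr (k + 1) * (b ^ j * of_bool (2 ^ j < 2 * H x)))"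
        using H0[of x] b0 by (intro sum_ennreal) auto
      also have "\<dots> \<le> ennreal (real N * H x * 2 powr (k + 1) * (b / (b - 1) * (2 * H x) powr (k - 1)))"
        unfolding sum_distrib_left[symmetric] using H0[of x] k
        by (intro ennreal_leI mult_left_mono truncated_geometric_sum_le) (auto simp: b_def)
      also have "real N * H x * 2 powr (k + 1) * (b / (b - 1) * (2 * H x) powr (k - 1)) = strong_type_const N k * (H x powr k)"
      proof (cases "H x = 0")
        case False
        then have hx: "0 < H x" using H0[of x] by simp
        have "(2 * H x) powr (k - 1) = 2 powr (k - 1) * H x powr (k - 1)" using hx by (simp add: powr_mult)
        moreover have "H x * H x powr (k - 1) = H x powr k" using hx powr_add[of "H x" 1 "k - 1"] by simp
        moreover have "2 powr (k + 1) * 2 powr (k - 1) = (2::real) powr (2 * k)" by (simp add: powr_add[symmetric])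
        ultimately have "real N * H x * 2 powr (k + 1) * (b / (b - 1) * (2 * H x) powr (k - 1))
          = real N * (2 powr (k + 1) * 2 powr (k - 1)) * (b / (b - 1)) * (H x * H x powr (k - 1))"
          by (simp add: mult_ac)
        then show ?thesis
          using \<open>H x * H x powr (k - 1) = H x powr k\<close> \<open>2 powr (k + 1) * 2 powr (k - 1) = (2::real) powr (2 * k)\<close>
          by (simp only: strong_type_const_def b_def)
      qed simp
      finally show ?thesis using strong_type_const_nonneg[OF k] by (simp add: ennreal_mult)
    qed
    then show ?thesis unfolding t by (intro suminf_le_const) auto
  qed
  have "(\<integral>\<^sup>+x. ennreal (u x powr k) \<partial>\<nu>)
      \<le> (\<integral>\<^sup>+x. 1 + (\<Sum>j. ennreal (2 powr (real (j + 1) * k)) * indicator (A j) x) \<partial>\<nu>)"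
    by (intro nn_integral_mono dyadic)
  also have "\<dots> = emeasure \<nu> (space \<nu>) + (\<Sum>j. ennreal (2 powr (real (j + 1) * k)) * emeasure \<nu> (A j))"
    by (subst nn_integral_add) (auto simp: nn_integral_suminf nn_integral_cmult_indicator)
  also have "\<dots> \<le> emeasure \<nu> (space \<nu>) + (\<Sum>j. ennreal (2 powr (real (j + 1) * k)) *
      (ennreal (2 / 2 ^ j * real N) * (\<integral>\<^sup>+y. ennreal (H y) * indicator (D j) y \<partial>\<nu>)))"
    by (intro add_left_mono suminf_le mult_left_mono weak) auto
  also have "(\<Sum>j. ennreal (2 powr (real (j + 1) * k)) *
      (ennreal (2 / 2 ^ j * real N) * (\<integral>\<^sup>+y. ennreal (H y) * indicator (D j) y \<partial>\<nu>)))
    = (\<integral>\<^sup>+x. (\<Sum>j. ennreal (2 powr (real (j + 1) * k)) * (ennreal (2 / 2 ^ j * real N) * (ennreal (H x) * indicator (D j) x))) \<partial>\<nu>)"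
    by (subst nn_integral_suminf) (auto simp: nn_integral_cmult)
  also have "\<dots> \<le> (\<integral>\<^sup>+x. ennreal (strong_type_const N k) * ennreal (H x powr k) \<partial>\<nu>)"
    by (intro nn_integral_mono pointwise)
  also have "\<dots> = ennreal (strong_type_const N k) * (\<integral>\<^sup>+x. ennreal (H x powr k) \<partial>\<nu>)"
    by (rule nn_integral_cmult) measurable
  finally show ?thesis unfolding N_def by (auto intro: add_left_mono)
qed

section \<open>Averages against a Muckenhoupt weight\<close>

text \<open>
  Since \<open>0 powr 0 = 0\<close>, the inequality also holds when \<open>\<theta>\<close> is \<open>0\<close> or \<open>1\<close>: a factor that vanishes almost
  everywhere annihilates the integrand.
\<close>

lemma nn_integral_Holder:
  fixes X Y :: "'a \<Rightarrow> real"
  assumes [measurable]: "X \<in> borel_measurable M" "Y \<in> borel_measurable M"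
    and nn: "\<And>x. 0 \<le> X x" "\<And>x. 0 \<le> Y x" "0 \<le> A" "0 \<le> B"
    and \<theta>: "0 \<le> \<theta>" "\<theta> \<le> 1"
    and X: "(\<integral>\<^sup>+x. ennreal (X x) \<partial>M) \<le> ennreal A" and Y: "(\<integral>\<^sup>+x. ennreal (Y x) \<partial>M) \<le> ennreal B"
  shows "(\<integral>\<^sup>+x. ennreal (X x powr \<theta> * Y x powr (1 - \<theta>)) \<partial>M) \<le> ennreal (A powr \<theta> * B powr (1 - \<theta>))"
proof (cases "A = 0 \<or> B = 0")
  case True
  then have "AE x in M. X x = 0 \<or> Y x = 0"
  proof
    assume "A = 0"
    then have "(\<integral>\<^sup>+x. ennreal (X x) \<partial>M) = 0" using X by simp
    then have "AE x in M. ennreal (X x) = 0" by (subst (asm) nn_integral_0_iff_AE) auto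
    then show ?thesis using nn(1) by (auto simp: ennreal_eq_0_iff intro: order_antisym elim!: eventually_mono)
  next
    assume "B = 0"
    then have "(\<integral>\<^sup>+x. ennreal (Y x) \<partial>M) = 0" using Y by simp
    then have "AE x in M. ennreal (Y x) = 0" by (subst (asm) nn_integral_0_iff_AE) auto
    then show ?thesis using nn(2) by (auto simp: ennreal_eq_0_iff intro: order_antisym elim!: eventually_mono)
  qed
  then have "(\<integral>\<^sup>+x. ennreal (X x powr \<theta> * Y x powr (1 - \<theta>)) \<partial>M) = (\<integral>\<^sup>+x. 0 \<partial>M)"
    by (intro nn_integral_cong_AE) (auto elim!: eventually_mono)
  then show ?thesis by simp
next
  case False
  then have pos: "0 < A" "0 < B" using nn by auto
  define K where "K = A powr \<theta> * B powr (1 - \<theta>)"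
  have K: "0 \<le> K" by (simp add: K_def)
  have "X x powr \<theta> * Y x powr (1 - \<theta>) \<le> K * (\<theta> / A * X x + (1 - \<theta>) / B * Y x)" for x
  proof -
    have "X x powr \<theta> * Y x powr (1 - \<theta>) = K * ((X x / A) powr \<theta> * (Y x / B) powr (1 - \<theta>))"
      using pos nn(1,2)[of x] by (simp add: K_def powr_divide)
    also have "\<dots> \<le> K * (\<theta> * (X x / A) + (1 - \<theta>) * (Y x / B))"
    proof (cases "X x = 0 \<or> Y x = 0")
      case False
      then show ?thesis
        using pos nn(1,2)[of x] \<theta> by (intro mult_left_mono Youngs_inequality_0 K) (auto simp: less_le)
    next
      case True
      have "0 \<le> K * (\<theta> * (X x / A) + (1 - \<theta>) * (Y x / B))"
        using pos nn(1,2)[of x] \<theta> K by (intro mult_nonneg_nonneg add_nonneg_nonneg) auto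
      then show ?thesis using True by auto
    qed
    finally show ?thesis by simp
  qed
  then have "(\<integral>\<^sup>+x. ennreal (X x powr \<theta> * Y x powr (1 - \<theta>)) \<partial>M) \<le>
      (\<integral>\<^sup>+x. ennreal K * (ennreal (\<theta> / A) * ennreal (X x) + ennreal ((1 - \<theta>) / B) * ennreal (Y x)) \<partial>M)"
    using pos nn \<theta> K
    by (intro nn_integral_mono) (simp add: ennreal_mult[symmetric] ennreal_plus[symmetric] ennreal_leI del: ennreal_plus)
  also have "\<dots> = ennreal K * (ennreal (\<theta> / A) * (\<integral>\<^sup>+x. ennreal (X x) \<partial>M) + ennreal ((1 - \<theta>) / B) * (\<integral>\<^sup>+x. ennreal (Y x) \<partial>M))"
    by (simp add: nn_integral_cmult nn_integral_add)
  also have "\<dots> \<le> ennreal K * (ennreal (\<theta> / A) * ennreal A + ennreal ((1 - \<theta>) / B) * ennreal B)"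
    by (intro mult_left_mono add_mono X Y) auto
  also have "\<dots> = ennreal K"
    using pos \<theta> K by (simp add: ennreal_mult[symmetric] ennreal_plus[symmetric] del: ennreal_plus)
  finally show ?thesis by (simp add: K_def)
qed

lemma set_nn_integral_pos:
  fixes k :: "'a \<Rightarrow> real"
  assumes Q: "Q \<in> sets M" "emeasure M Q \<noteq> 0"
    and [measurable]: "k \<in> borel_measurable M" and k: "\<And>x. 0 < k x"
  shows "0 < (\<integral>\<^sup>+x\<in>Q. ennreal (k x) \<partial>M)"
proof (rule ccontr)
  note [measurable] = Q(1)
  assume "\<not> 0 < (\<integral>\<^sup>+y\<in>Q. ennreal (k y) \<partial>M)"
  then have "(\<integral>\<^sup>+y\<in>Q. ennreal (k y) \<partial>M) = 0" by (simp add: zero_less_iff_neq_zero)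
  then have "AE y in M. ennreal (k y) * indicator Q y = 0" by (simp add: nn_integral_0_iff_AE)
  then have "AE y in M. y \<notin> Q"
    by (rule eventually_mono) (metis k ennreal_eq_0_iff indicator_simps(1) mult.right_neutral not_le)
  then have "emeasure M Q = 0" using AE_iff_measurable[of Q M "\<lambda>y. y \<notin> Q"] sets.sets_into_space[of Q M] Q by auto
  then show False using Q by simp
qed

text \<open>
  In terms of averages: \<open>(avg\<^sub>\<mu> h)\<^sup>\<sigma> \<le> C avg\<^sub>\<nu> (h\<^sup>\<sigma>)\<close> on each cube centred in \<open>\<Omega>\<close>, for \<open>\<nu>\<close> with density \<open>v\<close> on \<open>\<Omega>\<close>.
  The average of \<open>h\<close> enters through its lower bounds \<open>B\<close>, which avoids quotients and infinite values.
\<close>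

definition average_bound :: "(real ^ 'n) measure \<Rightarrow> (real ^ 'n) set \<Rightarrow> (real ^ 'n \<Rightarrow> real) \<Rightarrow> real \<Rightarrow> real \<Rightarrow> bool" where
  "average_bound \<mu> \<Omega> v \<sigma> C \<longleftrightarrow> (\<forall>z\<in>\<Omega>. \<forall>l>0. \<forall>B\<ge>0. \<forall>h\<in>borel_measurable \<mu>.
     (\<forall>x. 0 \<le> h x) \<and> ennreal B * emeasure \<mu> (cube z l) \<le> (\<integral>\<^sup>+x\<in>cube z l \<inter> \<Omega>. ennreal (h x) \<partial>\<mu>) \<longrightarrow>
     ennreal (B powr \<sigma>) * (\<integral>\<^sup>+x\<in>cube z l \<inter> \<Omega>. ennreal (v x) \<partial>\<mu>)
       \<le> ennreal C * (\<integral>\<^sup>+x\<in>cube z l \<inter> \<Omega>. ennreal (h x powr \<sigma> * v x) \<partial>\<mu>))"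

text \<open>
  For \<open>\<sigma> > 1\<close> this is Hoelder's inequality for \<open>h = (h\<^sup>\<sigma> v)\<^bsup>1/\<sigma>\<^esup> V\<^bsup>1-1/\<sigma>\<^esup>\<close> with \<open>V = v\<^bsup>-1/(\<sigma>-1)\<^esup>\<close>, combined with
  the Muckenhoupt condition; for \<open>\<sigma> = 1\<close> the weight is almost everywhere at least a multiple of its average.
\<close>

lemma muckenhoupt_average:
  fixes \<mu> :: "(real ^ 'n) measure" and v :: "real ^ 'n \<Rightarrow> real"
  assumes sets: "sets borel \<subseteq> sets \<mu>" and \<Omega>[measurable]: "\<Omega> \<in> sets \<mu>"
    and cubes_finite: "\<forall>x\<in>\<Omega>. \<forall>l>0. emeasure \<mu> (cube x l) < \<infinity>"
    and v[measurable]: "v \<in> borel_measurable \<mu>" and v0: "\<And>x. 0 < v x"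
    and \<sigma>: "1 \<le> \<sigma>" and A: "muckenhoupt \<mu> \<Omega> \<sigma> (\<lambda>x. ennreal (v x))"
  obtains C :: real where "0 < C" "average_bound \<mu> \<Omega> v \<sigma> C"
proof -
  have cs[measurable]: "cube x l \<in> sets \<mu>" for x l
    by (rule cube_sets[OF sets])
  show ?thesis
  proof (cases "\<sigma> = 1")
    case True
    with A obtain C :: real where C: "0 < C" and AE: "\<And>z l. z \<in> \<Omega> \<Longrightarrow> 0 < l \<Longrightarrow> AE x in \<mu>. x \<in> cube z l \<inter> \<Omega> \<longrightarrow>
          (\<integral>\<^sup>+y\<in>cube z l \<inter> \<Omega>. ennreal (v y) \<partial>\<mu>) / emeasure \<mu> (cube z l) \<le> ennreal C * ennreal (v x)"
      unfolding muckenhoupt_def by auto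
    show ?thesis
    proof (rule that[OF C], unfold average_bound_def, intro ballI allI impI, elim conjE)
      fix z l B and h :: "real ^ 'n \<Rightarrow> real"
      assume z: "z \<in> \<Omega>" "0 < l" "0 \<le> B" and h[measurable]: "h \<in> borel_measurable \<mu>" and h_nonneg: "\<forall>x. 0 \<le> h x"
        and le: "ennreal B * emeasure \<mu> (cube z l) \<le> (\<integral>\<^sup>+x\<in>cube z l \<inter> \<Omega>. ennreal (h x) \<partial>\<mu>)"
      note h0 = h_nonneg[rule_format]
      define m where "m = emeasure \<mu> (cube z l)"
      define N where "N = (\<integral>\<^sup>+y\<in>cube z l \<inter> \<Omega>. ennreal (v y) \<partial>\<mu>)"
      define X where "X = (\<integral>\<^sup>+x\<in>cube z l \<inter> \<Omega>. ennreal (h x powr \<sigma> * v x) \<partial>\<mu>)"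
      have m_fin: "m < \<infinity>" unfolding m_def using cubes_finite z by blast
      have "ennreal (B powr \<sigma>) * N \<le> ennreal C * X"
      proof (cases "m = 0")
        case True
        then have "AE x in \<mu>. x \<notin> cube z l" unfolding m_def by (intro AE_not_in) (auto simp: null_sets_def)
        then have "N = (\<integral>\<^sup>+y. 0 \<partial>\<mu>)" unfolding N_def
          by (intro nn_integral_cong_AE) (auto elim!: eventually_mono)
        then show ?thesis by simp
      next
        case False
        have "ennreal (B powr \<sigma>) * N * m = N * (ennreal B * m)"
          using True z(3) by (simp add: mult_ac)
        also have "\<dots> \<le> N * (\<integral>\<^sup>+x\<in>cube z l \<inter> \<Omega>. ennreal (h x) \<partial>\<mu>)"
          using le by (intro mult_left_mono) (auto simp: m_def)
        also have "\<dots> = (\<integral>\<^sup>+x. N * (ennreal (h x) * indicator (cube z l \<inter> \<Omega>) x) \<partial>\<mu>)"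
          by (rule nn_integral_cmult[symmetric]) measurable
        also have "\<dots> \<le> (\<integral>\<^sup>+x. m * ennreal C * (ennreal (h x powr \<sigma> * v x) * indicator (cube z l \<inter> \<Omega>) x) \<partial>\<mu>)"
        proof (rule nn_integral_mono_AE, use AE[OF z(1,2)] in eventually_elim)
          fix x assume *: "x \<in> cube z l \<inter> \<Omega> \<longrightarrow>
             (\<integral>\<^sup>+y\<in>cube z l \<inter> \<Omega>. ennreal (v y) \<partial>\<mu>) / emeasure \<mu> (cube z l) \<le> ennreal C * ennreal (v x)"
          show "N * (ennreal (h x) * indicator (cube z l \<inter> \<Omega>) x) \<le>
            m * ennreal C * (ennreal (h x powr \<sigma> * v x) * indicator (cube z l \<inter> \<Omega>) x)"
          proof (cases "x \<in> cube z l \<inter> \<Omega>")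
            case x: True
            have "N = m * (N / m)"
              using False m_fin by (simp add: ennreal_times_divide mult.commute[of m] mult_divide_eq_ennreal)
            also have "\<dots> \<le> m * (ennreal C * ennreal (v x))"
              using * x by (intro mult_left_mono) (auto simp: N_def m_def)
            finally have "N * ennreal (h x) \<le> m * (ennreal C * ennreal (v x)) * ennreal (h x)"
              by (rule mult_right_mono) simp
            then show ?thesis using x True h0[of x] v0[of x] by (simp add: ennreal_mult mult_ac)
          qed simp
        qed
        also have "\<dots> = m * ennreal C * X"
          unfolding X_def by (rule nn_integral_cmult) measurable
        finally have "m * (ennreal (B powr \<sigma>) * N) \<le> m * (ennreal C * X)" by (simp add: mult_ac)
        then show ?thesis using False m_fin by (simp add: ennreal_mult_le_mult_iff)
      qed
      then show "ennreal (B powr \<sigma>) * (\<integral>\<^sup>+x\<in>cube z l \<inter> \<Omega>. ennreal (v x) \<partial>\<mu>)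
        \<le> ennreal C * (\<integral>\<^sup>+x\<in>cube z l \<inter> \<Omega>. ennreal (h x powr \<sigma> * v x) \<partial>\<mu>)"
        by (simp add: N_def X_def)
    qed
  next
    case False
    then have \<sigma>1: "1 < \<sigma>" using \<sigma> by simp
    define V where "V = (\<lambda>x. v x powr (- 1 / (\<sigma> - 1)))"
    have V[measurable]: "V \<in> borel_measurable \<mu>" unfolding V_def by measurable
    have V0: "0 < V x" for x using v0[of x] by (simp add: V_def)
    have ep: "(ennreal (v x)) epowr (- 1 / (\<sigma> - 1)) = ennreal (V x)" for x
      using v0[of x] \<sigma>1 by (simp add: epowr_def V_def)
    from A False obtain C :: real where C: "0 < C" and CA: "\<And>z l. z \<in> \<Omega> \<Longrightarrow> 0 < l \<Longrightarrow>
        ((\<integral>\<^sup>+y\<in>cube z l \<inter> \<Omega>. ennreal (v y) \<partial>\<mu>) / emeasure \<mu> (cube z l)) *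
        ((\<integral>\<^sup>+y\<in>cube z l \<inter> \<Omega>. ennreal (V y) \<partial>\<mu>) / emeasure \<mu> (cube z l)) epowr (\<sigma> - 1) \<le> ennreal C"
      unfolding muckenhoupt_def ep by auto
    show ?thesis
    proof (rule that[OF C], unfold average_bound_def, intro ballI allI impI, elim conjE)
      fix z l B and h :: "real ^ 'n \<Rightarrow> real"
      assume z: "z \<in> \<Omega>" "0 < l" "0 \<le> B" and h[measurable]: "h \<in> borel_measurable \<mu>" and h_nonneg: "\<forall>x. 0 \<le> h x"
        and le: "ennreal B * emeasure \<mu> (cube z l) \<le> (\<integral>\<^sup>+x\<in>cube z l \<inter> \<Omega>. ennreal (h x) \<partial>\<mu>)"
      note h0 = h_nonneg[rule_format]
      define Q where "Q = cube z l \<inter> \<Omega>"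
      have [measurable]: "Q \<in> sets \<mu>" by (simp add: Q_def)
      define m' where "m' = emeasure \<mu> (cube z l)"
      define N' where "N' = (\<integral>\<^sup>+y\<in>Q. ennreal (v y) \<partial>\<mu>)"
      define J' where "J' = (\<integral>\<^sup>+y\<in>Q. ennreal (V y) \<partial>\<mu>)"
      define X' where "X' = (\<integral>\<^sup>+x\<in>Q. ennreal (h x powr \<sigma> * v x) \<partial>\<mu>)"
      have CA': "(N' / m') * (J' / m') epowr (\<sigma> - 1) \<le> ennreal C"
        using CA[OF z(1,2)] unfolding N'_def J'_def m'_def Q_def .
      have m_fin: "m' < \<infinity>" unfolding m'_def using cubes_finite z by blast
      have "ennreal (B powr \<sigma>) * N' \<le> ennreal C * X'"
      proof (cases "emeasure \<mu> Q = 0 \<or> X' = \<infinity>")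
        case True
        then show ?thesis
        proof
          assume "emeasure \<mu> Q = 0"
          then have "AE x in \<mu>. x \<notin> Q" by (intro AE_not_in) (auto simp: null_sets_def)
          then have "N' = (\<integral>\<^sup>+y. 0 \<partial>\<mu>)" unfolding N'_def
            by (intro nn_integral_cong_AE) (auto elim!: eventually_mono)
          then show ?thesis by simp
        next
          assume "X' = \<infinity>"
          then show ?thesis using C by (simp add: ennreal_mult_top)
        qed
      next
        case nz: False
        have Q: "Q \<in> sets \<mu>" "emeasure \<mu> Q \<noteq> 0" using nz by auto
        have N0: "0 < N'" unfolding N'_def by (rule set_nn_integral_pos[OF Q v v0])
        have J0: "0 < J'" unfolding J'_def by (rule set_nn_integral_pos[OF Q V V0])
        have "emeasure \<mu> Q \<le> m'" unfolding m'_def by (intro emeasure_mono) (auto simp: Q_def)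
        then have m0: "0 < m'" using nz by (metis le_zero_eq zero_less_iff_neq_zero)
        have J1: "J' < \<infinity>"
        proof (rule ccontr)
          assume "\<not> J' < \<infinity>"
          then have "J' = \<infinity>" by (simp add: less_top[symmetric])
          then have "J' / m' = \<infinity>" using m_fin by (simp add: ennreal_top_divide)
          then have "(J' / m') epowr (\<sigma> - 1) = \<infinity>" using \<sigma>1 by (simp add: epowr_def)
          moreover have "N' / m' \<noteq> 0" using N0 m_fin by (auto simp: ennreal_divide_eq_0_iff)
          ultimately show False using CA' by (simp add: ennreal_mult_top top_unique)
        qed
        obtain m where m: "m' = ennreal m" "0 < m" using m_fin m0 by (cases m') auto
        obtain J where J: "J' = ennreal J" "0 < J" using J0 J1 by (cases J') auto
        have Jm: "J' / m' = ennreal (J / m)" using m J by (simp add: divide_ennreal)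
        then have Jp: "(J' / m') epowr (\<sigma> - 1) = ennreal ((J / m) powr (\<sigma> - 1))"
          using m J \<sigma>1 by (simp add: epowr_def)
        have N1: "N' < \<infinity>"
        proof (rule ccontr)
          assume "\<not> N' < \<infinity>"
          then have "N' = \<infinity>" by (simp add: less_top[symmetric])
          then have "N' / m' = \<infinity>" using m_fin by (simp add: ennreal_top_divide)
          then show False using CA' Jp m J by (simp add: ennreal_top_mult top_unique)
        qed
        obtain N where N: "N' = ennreal N" "0 < N" using N0 N1 by (cases N') auto
        obtain X where X: "X' = ennreal X" "0 \<le> X" using nz by (cases X') auto
        have "(\<integral>\<^sup>+x. ennreal ((h x powr \<sigma> * v x * indicator Q x) powr (1/\<sigma>) * (V x * indicator Q x) powr (1 - 1/\<sigma>)) \<partial>\<mu>)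
           \<le> ennreal (X powr (1/\<sigma>) * J powr (1 - 1/\<sigma>))"
        proof (rule nn_integral_Holder)
          have "(\<integral>\<^sup>+x. ennreal (h x powr \<sigma> * v x * indicator Q x) \<partial>\<mu>) = X'"
            unfolding X'_def by (intro nn_integral_cong) (simp add: indicator_def)
          then show "(\<integral>\<^sup>+x. ennreal (h x powr \<sigma> * v x * indicator Q x) \<partial>\<mu>) \<le> ennreal X" using X by simp
          have "(\<integral>\<^sup>+x. ennreal (V x * indicator Q x) \<partial>\<mu>) = J'"
            unfolding J'_def by (intro nn_integral_cong) (simp add: indicator_def)
          then show "(\<integral>\<^sup>+x. ennreal (V x * indicator Q x) \<partial>\<mu>) \<le> ennreal J" using J by simp
        qed (use \<sigma>1 X J v0 V0 in \<open>auto intro!: mult_nonneg_nonneg intro: less_imp_le\<close>)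
        also have "(\<integral>\<^sup>+x. ennreal ((h x powr \<sigma> * v x * indicator Q x) powr (1/\<sigma>) * (V x * indicator Q x) powr (1 - 1/\<sigma>)) \<partial>\<mu>)
          = (\<integral>\<^sup>+x\<in>Q. ennreal (h x) \<partial>\<mu>)"
        proof (rule nn_integral_cong)
          fix x
          have "(h x powr \<sigma> * v x) powr (1/\<sigma>) * V x powr (1 - 1/\<sigma>) = h x * (v x powr (1/\<sigma>) * v x powr (- 1 / (\<sigma> - 1) * (1 - 1/\<sigma>)))"
            using \<sigma>1 h0[of x] v0[of x] by (simp add: powr_mult powr_powr V_def less_imp_le)
          also have "- 1 / (\<sigma> - 1) * (1 - 1/\<sigma>) = - (1/\<sigma>)" using \<sigma>1 by (simp add: field_simps)
          also have "v x powr (1/\<sigma>) * v x powr (- (1/\<sigma>)) = 1" using v0[of x] by (simp add: powr_minus)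
          finally show "ennreal ((h x powr \<sigma> * v x * indicator Q x) powr (1/\<sigma>) * (V x * indicator Q x) powr (1 - 1/\<sigma>))
            = ennreal (h x) * indicator Q x"
            by (simp add: indicator_def)
        qed
        finally have "ennreal B * ennreal m \<le> ennreal (X powr (1/\<sigma>) * J powr (1 - 1/\<sigma>))"
          using le unfolding m'_def[symmetric] Q_def[symmetric] m by (rule order_trans[rotated])
        then have "B * m \<le> X powr (1/\<sigma>) * J powr (1 - 1/\<sigma>)"
          using z(3) m by (simp add: ennreal_mult[symmetric])
        then have "(B * m) powr \<sigma> \<le> (X powr (1/\<sigma>) * J powr (1 - 1/\<sigma>)) powr \<sigma>"
          using z(3) m \<sigma>1 by (intro powr_mono2) auto
        also have "\<dots> = X * J powr (\<sigma> - 1)"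
        proof -
          have "(1 - 1/\<sigma>) * \<sigma> = \<sigma> - 1" using \<sigma>1 by (simp add: field_simps)
          then show ?thesis using X J \<sigma>1 by (simp add: powr_mult powr_powr)
        qed
        finally have 1: "B powr \<sigma> * m powr \<sigma> \<le> X * J powr (\<sigma> - 1)" using z(3) m by (simp add: powr_mult)
        have "ennreal (N / m * (J / m) powr (\<sigma> - 1)) = ennreal (N / m) * ennreal ((J / m) powr (\<sigma> - 1))"
          using N m by (intro ennreal_mult) auto
        also have "\<dots> \<le> ennreal C"
          using CA' unfolding Jp unfolding N m using N m by (simp add: divide_ennreal)
        finally have "ennreal (N / m * (J / m) powr (\<sigma> - 1)) \<le> ennreal C" .
        then have "N / m * (J / m) powr (\<sigma> - 1) \<le> C" using C by (simp add: ennreal_le_iff)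
        moreover have "N / m * (J / m) powr (\<sigma> - 1) = N * J powr (\<sigma> - 1) / m powr \<sigma>"
          using m J powr_add[of m "\<sigma> - 1" 1] by (simp add: powr_divide)
        ultimately have "N * J powr (\<sigma> - 1) / m powr \<sigma> \<le> C" by (simp only:)
        then have 2: "N * J powr (\<sigma> - 1) \<le> C * m powr \<sigma>" using m by (subst (asm) pos_divide_le_eq) auto
        have "(B powr \<sigma> * N) * m powr \<sigma> \<le> (X * J powr (\<sigma> - 1)) * N"
          using 1 N by (metis less_imp_le mult.assoc mult.commute mult_right_mono)
        also have "\<dots> = X * (N * J powr (\<sigma> - 1))" by simp
        also have "\<dots> \<le> X * (C * m powr \<sigma>)" using 2 X by (intro mult_left_mono) auto
        finally have "(B powr \<sigma> * N) * m powr \<sigma> \<le> (C * X) * m powr \<sigma>" by (simp add: mult_ac)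
        then have "B powr \<sigma> * N \<le> C * X" using m by simp
        then show ?thesis using N X C by (simp add: ennreal_mult[symmetric] ennreal_leI)
      qed
      then show "ennreal (B powr \<sigma>) * (\<integral>\<^sup>+x\<in>cube z l \<inter> \<Omega>. ennreal (v x) \<partial>\<mu>)
        \<le> ennreal C * (\<integral>\<^sup>+x\<in>cube z l \<inter> \<Omega>. ennreal (h x powr \<sigma> * v x) \<partial>\<mu>)"
        by (simp add: N'_def X'_def Q_def)
    qed
  qed
qed

section \<open>Integrability of the weight, small cubes and log-Hoelder exponents\<close>

text \<open>
  A single cube contains the bounded set \<open>\<Omega>\<close>, so the condition on this cube bounds the integrals of \<open>v\<close> and of
  \<open>v\<^bsup>-1/(\<sigma>-1)\<^esup>\<close> over \<open>\<Omega>\<close>: neither of the two factors vanishes, hence neither is infinite. Where \<open>s \<ge> r > \<sigma>\<close>, the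
  power \<open>v\<^bsup>-1/(s-1)\<^esup>\<close> is at most \<open>1 + v\<^bsup>-1/(\<sigma>-1)\<^esup>\<close>. For \<open>\<sigma> = 1\<close> the weight is bounded below instead.
\<close>

lemma muckenhoupt_integrable:
  fixes \<mu> :: "(real ^ 'n) measure" and v :: "real ^ 'n \<Rightarrow> real"
  assumes sets: "sets borel \<subseteq> sets \<mu>" and \<Omega>[measurable]: "\<Omega> \<in> sets \<mu>" and bd: "bounded \<Omega>"
    and cubes_finite: "\<forall>x\<in>\<Omega>. \<forall>l>0. emeasure \<mu> (cube x l) < \<infinity>"
    and v[measurable]: "v \<in> borel_measurable \<mu>" and v0: "\<And>x. 0 < v x"
    and \<sigma>: "1 \<le> \<sigma>" and A: "muckenhoupt \<mu> \<Omega> \<sigma> (\<lambda>x. ennreal (v x))"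
    and pos: "emeasure \<mu> \<Omega> \<noteq> 0"
  shows "emeasure \<mu> \<Omega> < \<infinity>" "(\<integral>\<^sup>+x\<in>\<Omega>. ennreal (v x) \<partial>\<mu>) < \<infinity>"
    "\<sigma> < r \<Longrightarrow> E \<subseteq> \<Omega> \<Longrightarrow> (\<And>x. x \<in> E \<Longrightarrow> r \<le> s x) \<Longrightarrow> (\<integral>\<^sup>+x\<in>E. ennreal (v x powr (- 1 / (s x - 1))) \<partial>\<mu>) < \<infinity>"
proof -
  have cs[measurable]: "cube x l \<in> sets \<mu>" for x l
    by (rule cube_sets[OF sets])
  obtain z where z: "z \<in> \<Omega>" using pos by (metis emeasure_empty ex_in_conv)
  obtain R where R: "\<And>x. x \<in> \<Omega> \<Longrightarrow> dist z x \<le> R" using bd bounded_any_center by metis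
  define l where "l = 2 * \<bar>R\<bar> + 1"
  have l: "0 < l" by (simp add: l_def)
  have sub: "\<Omega> \<subseteq> cube z l"
  proof
    fix x assume "x \<in> \<Omega>"
    then have "dist x z \<le> R" using R by (simp add: dist_commute)
    moreover have "\<bar>x $ i - z $ i\<bar> \<le> dist x z" for i
      using component_le_norm_cart[of "x - z" i] by (simp add: dist_norm)
    ultimately have "\<bar>x $ i - z $ i\<bar> \<le> R" for i by (rule order_trans[rotated])
    moreover have "R \<le> l / 2" by (simp add: l_def)
    ultimately have "\<bar>x $ i - z $ i\<bar> \<le> l / 2" for i by (rule order_trans)
    then show "x \<in> cube z l" by (simp add: cube_def)
  qed
  then have cut: "cube z l \<inter> \<Omega> = \<Omega>" by blast
  define m where "m = emeasure \<mu> (cube z l)"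
  have m: "m < \<infinity>" unfolding m_def using cubes_finite z l by blast
  have le_m: "emeasure \<mu> \<Omega> \<le> m" unfolding m_def using sub by (intro emeasure_mono) auto
  then show fin\<Omega>: "emeasure \<mu> \<Omega> < \<infinity>" using m by (rule le_less_trans)
  have m0: "m \<noteq> 0" using le_m pos by (metis le_zero_eq)
  note pos_int = set_nn_integral_pos[OF \<Omega> pos, THEN less_imp_neq, THEN not_sym]
  define N where "N = (\<integral>\<^sup>+x\<in>\<Omega>. ennreal (v x) \<partial>\<mu>)"
  have N0: "N \<noteq> 0" unfolding N_def by (rule pos_int) (use v0 in auto)
  have "N < \<infinity> \<and> (\<sigma> < r \<longrightarrow> E \<subseteq> \<Omega> \<longrightarrow> (\<forall>x\<in>E. r \<le> s x) \<longrightarrow> (\<integral>\<^sup>+x\<in>E. ennreal (v x powr (- 1 / (s x - 1))) \<partial>\<mu>) < \<infinity>)"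
  proof (cases "\<sigma> = 1")
    case True
    with A obtain C :: real where C: "0 < C" and "\<And>z l. z \<in> \<Omega> \<Longrightarrow> 0 < l \<Longrightarrow> AE x in \<mu>. x \<in> cube z l \<inter> \<Omega> \<longrightarrow>
          (\<integral>\<^sup>+y\<in>cube z l \<inter> \<Omega>. ennreal (v y) \<partial>\<mu>) / emeasure \<mu> (cube z l) \<le> ennreal C * ennreal (v x)"
      unfolding muckenhoupt_def by auto
    from this(2)[OF z l] have AE: "AE x in \<mu>. x \<in> \<Omega> \<longrightarrow> N / m \<le> ennreal C * ennreal (v x)"
      unfolding cut N_def m_def .
    have N1: "N < \<infinity>"
    proof (rule ccontr)
      assume "\<not> N < \<infinity>"
      then have "N / m = \<infinity>" using m by (simp add: less_top[symmetric] ennreal_top_divide)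
      then have "AE x in \<mu>. x \<notin> \<Omega>" using AE
        by (elim eventually_mono) (auto simp: top_unique ennreal_mult_eq_top_iff)
      then have "emeasure \<mu> \<Omega> = 0" using AE_iff_measurable[of \<Omega> \<mu> "\<lambda>y. y \<notin> \<Omega>"] sets.sets_into_space[of \<Omega> \<mu>] by auto
      then show False using pos by simp
    qed
    obtain n where n: "N = ennreal n" "0 < n" using N0 N1 by (cases N) (auto simp: less_le)
    obtain m' where m': "m = ennreal m'" "0 < m'" using m0 m by (cases m) (auto simp: less_le)
    define c where "c = n / m' / C"
    have c0: "0 < c" using n m' C by (simp add: c_def)
    have AEc: "AE x in \<mu>. x \<in> \<Omega> \<longrightarrow> c \<le> v x"
      using AE
    proof eventually_elim
      case (elim x)
      show ?case
      proof
        assume "x \<in> \<Omega>"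
        then have "ennreal (n / m') \<le> ennreal (C * v x)"
          using elim n m' C v0[of x] by (simp add: divide_ennreal ennreal_mult less_imp_le)
        then show "c \<le> v x" using n m' C v0[of x] by (simp add: c_def field_simps ennreal_le_iff less_imp_le)
      qed
    qed
    have "(\<integral>\<^sup>+x\<in>E. ennreal (v x powr (- 1 / (s x - 1))) \<partial>\<mu>) < \<infinity>"
      if r: "\<sigma> < r" "E \<subseteq> \<Omega>" "\<forall>x\<in>E. r \<le> s x"
    proof -
      define K where "K = max 1 (c powr (- 1 / (r - 1)))"
      have "(\<integral>\<^sup>+x\<in>E. ennreal (v x powr (- 1 / (s x - 1))) \<partial>\<mu>) \<le> (\<integral>\<^sup>+x. ennreal K * indicator \<Omega> x \<partial>\<mu>)"
      proof (rule nn_integral_mono_AE, use AEc in eventually_elim)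
        case (elim x)
        show ?case
        proof (cases "x \<in> E")
          case xE: True
          then have cv: "c \<le> v x" and sx: "r \<le> s x" using elim r by auto
          have "v x powr (- 1 / (s x - 1)) \<le> K"
          proof (cases "1 \<le> v x")
            case True
            have "v x powr (- 1 / (s x - 1)) \<le> v x powr 0" using True r sx \<sigma> by (intro powr_mono) auto
            then show ?thesis using v0[of x] by (simp add: K_def)
          next
            case False
            have "v x powr (- 1 / (s x - 1)) \<le> v x powr (- 1 / (r - 1))"
              using False v0[of x] r sx \<sigma> by (intro powr_mono') (auto simp: frac_le)
            also have "\<dots> \<le> c powr (- 1 / (r - 1))"
              using cv c0 r \<sigma> by (intro powr_mono2') auto
            finally show ?thesis by (simp add: K_def)
          qed
          then have "ennreal (v x powr (- 1 / (s x - 1))) \<le> ennreal K" by (rule ennreal_leI)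
          moreover have "x \<in> \<Omega>" using xE r by blast
          ultimately show ?thesis using xE by simp
        qed simp
      qed
      also have "\<dots> = ennreal K * emeasure \<mu> \<Omega>" by (rule nn_integral_cmult_indicator) simp
      also have "\<dots> < \<infinity>" using fin\<Omega> by (simp add: ennreal_mult_less_top)
      finally show ?thesis .
    qed
    then show ?thesis using N1 by blast
  next
    case False
    then have \<sigma>1: "1 < \<sigma>" using \<sigma> by simp
    define V where "V = (\<lambda>x. v x powr (- 1 / (\<sigma> - 1)))"
    have V[measurable]: "V \<in> borel_measurable \<mu>" unfolding V_def by measurable
    have V0: "0 < V x" for x using v0[of x] by (simp add: V_def)
    have ep: "(ennreal (v x)) epowr (- 1 / (\<sigma> - 1)) = ennreal (V x)" for x
      using v0[of x] \<sigma>1 by (simp add: epowr_def V_def)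
    define J where "J = (\<integral>\<^sup>+y\<in>\<Omega>. ennreal (V y) \<partial>\<mu>)"
    from A False obtain C :: real where "\<And>z l. z \<in> \<Omega> \<Longrightarrow> 0 < l \<Longrightarrow>
        ((\<integral>\<^sup>+y\<in>cube z l \<inter> \<Omega>. ennreal (v y) \<partial>\<mu>) / emeasure \<mu> (cube z l)) *
        ((\<integral>\<^sup>+y\<in>cube z l \<inter> \<Omega>. ennreal (V y) \<partial>\<mu>) / emeasure \<mu> (cube z l)) epowr (\<sigma> - 1) \<le> ennreal C"
      unfolding muckenhoupt_def ep by auto
    from this[OF z l] have C: "(N / m) * (J / m) epowr (\<sigma> - 1) \<le> ennreal C"
      unfolding cut N_def J_def m_def .
    have J0: "J \<noteq> 0" unfolding J_def by (rule pos_int) (use V0 in auto)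
    have Nm: "N / m \<noteq> 0" using N0 m by (auto simp: ennreal_divide_eq_0_iff)
    have Jm: "J / m \<noteq> 0" using J0 m by (auto simp: ennreal_divide_eq_0_iff)
    then have Jm': "(J / m) epowr (\<sigma> - 1) \<noteq> 0" using \<sigma>1 by (auto simp: epowr_def ennreal_eq_0_iff enn2real_eq_0_iff)
    have N1: "N < \<infinity>"
    proof (rule ccontr)
      assume "\<not> N < \<infinity>"
      then have "N / m = \<infinity>" using m by (simp add: less_top[symmetric] ennreal_top_divide)
      then show False using C Jm' by (simp add: ennreal_top_mult top_unique)
    qed
    have J1: "J < \<infinity>"
    proof (rule ccontr)
      assume "\<not> J < \<infinity>"
      then have "J / m = \<infinity>" using m by (simp add: less_top[symmetric] ennreal_top_divide)
      then have "(J / m) epowr (\<sigma> - 1) = \<infinity>" using \<sigma>1 by (simp add: epowr_def)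
      then show False using C Nm by (simp add: ennreal_mult_top top_unique)
    qed
    have "(\<integral>\<^sup>+x\<in>E. ennreal (v x powr (- 1 / (s x - 1))) \<partial>\<mu>) < \<infinity>"
      if r: "\<sigma> < r" "E \<subseteq> \<Omega>" "\<forall>x\<in>E. r \<le> s x"
    proof -
      have "(\<integral>\<^sup>+x\<in>E. ennreal (v x powr (- 1 / (s x - 1))) \<partial>\<mu>) \<le> (\<integral>\<^sup>+x. indicator \<Omega> x + ennreal (V x) * indicator \<Omega> x \<partial>\<mu>)"
      proof (rule nn_integral_mono)
        fix x
        show "ennreal (v x powr (- 1 / (s x - 1))) * indicator E x \<le> indicator \<Omega> x + ennreal (V x) * indicator \<Omega> x"
        proof (cases "x \<in> E")
          case xE: True
          then have sx: "r \<le> s x" using r by auto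
          have "v x powr (- 1 / (s x - 1)) \<le> 1 + V x"
          proof (cases "1 \<le> v x")
            case True
            have "v x powr (- 1 / (s x - 1)) \<le> v x powr 0" using True r sx \<sigma> by (intro powr_mono) auto
            then show ?thesis using v0[of x] V0[of x] by simp
          next
            case False
            have "v x powr (- 1 / (s x - 1)) \<le> v x powr (- 1 / (\<sigma> - 1))"
              using False v0[of x] r sx \<sigma>1 by (intro powr_mono') (auto simp: frac_le)
            then show ?thesis by (simp add: V_def)
          qed
          then have "ennreal (v x powr (- 1 / (s x - 1))) \<le> ennreal (1 + V x)" by (rule ennreal_leI)
          also have "\<dots> = 1 + ennreal (V x)" using V0[of x] by (simp add: less_imp_le)
          finally show ?thesis using xE r by auto
        qed simp
      qed
      also have "\<dots> = emeasure \<mu> \<Omega> + J" unfolding J_def by (subst nn_integral_add) auto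
      also have "\<dots> < \<infinity>" using fin\<Omega> J1 by simp
      finally show ?thesis .
    qed
    then show ?thesis using N1 by blast
  qed
  then show "(\<integral>\<^sup>+x\<in>\<Omega>. ennreal (v x) \<partial>\<mu>) < \<infinity>"
    "\<sigma> < r \<Longrightarrow> E \<subseteq> \<Omega> \<Longrightarrow> (\<And>x. x \<in> E \<Longrightarrow> r \<le> s x) \<Longrightarrow> (\<integral>\<^sup>+x\<in>E. ennreal (v x powr (- 1 / (s x - 1))) \<partial>\<mu>) < \<infinity>"
    by (auto simp: N_def)
qed

text \<open>
  Sides between the diameter of \<open>\<Omega>\<close> and \<open>1\<close> are handled by the cube with half the diameter as its side. If \<open>\<Omega>\<close>
  is a single point, lower regularity is vacuous, but then every cube centred in \<open>\<Omega>\<close> contains this atom.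
\<close>

lemma lower_ahlfors_regular_unit:
  fixes \<mu> :: "(real ^ 'n) measure"
  assumes sets: "sets borel \<subseteq> sets \<mu>" and \<Omega>: "\<Omega> \<in> sets \<mu>" "bounded \<Omega>" "emeasure \<mu> \<Omega> \<noteq> 0" "emeasure \<mu> \<Omega> < \<infinity>"
    and \<beta>: "0 < \<beta>" and reg: "lower_ahlfors_regular \<mu> \<beta> \<Omega>"
  obtains c where "0 < c" "\<forall>x\<in>\<Omega>. \<forall>l. 0 < l \<and> l \<le> 1 \<longrightarrow> ennreal (c * l powr \<beta>) \<le> emeasure \<mu> (cube x l)"
proof -
  have cs: "cube x l \<in> sets \<mu>" for x l
    by (rule cube_sets[OF sets])
  obtain c where c: "0 < c" and reg': "\<And>x l. x \<in> \<Omega> \<Longrightarrow> 0 < l \<Longrightarrow> l < diameter \<Omega> \<Longrightarrow> ennreal (c * l powr \<beta>) \<le> emeasure \<mu> (cube x l)"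
    using reg by (auto simp: lower_ahlfors_regular_def)
  show ?thesis
  proof (cases "0 < diameter \<Omega>")
    case True
    define d where "d = diameter \<Omega> / 2"
    define c' where "c' = min c (c * d powr \<beta>)"
    have d: "0 < d" "d < diameter \<Omega>" using True by (auto simp: d_def)
    have c': "0 < c'" using c d by (simp add: c'_def)
    show ?thesis
    proof (rule that[OF c'], intro ballI allI impI, elim conjE)
      fix x and l :: real
      assume x: "x \<in> \<Omega>" and l: "0 < l" "l \<le> 1"
      show "ennreal (c' * l powr \<beta>) \<le> emeasure \<mu> (cube x l)"
      proof (cases "l < diameter \<Omega>")
        case True
        have "c' * l powr \<beta> \<le> c * l powr \<beta>" by (intro mult_right_mono) (auto simp: c'_def)
        then show ?thesis using reg'[OF x l(1) True] by (meson ennreal_leI order_trans)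
      next
        case False
        have "l powr \<beta> \<le> 1" using l \<beta> by (intro powr_le1) auto
        then have "c' * l powr \<beta> \<le> (c * d powr \<beta>) * 1"
          using c d by (intro mult_mono) (auto simp: c'_def)
        then have "ennreal (c' * l powr \<beta>) \<le> ennreal (c * d powr \<beta>)" by (intro ennreal_leI) simp
        also have "\<dots> \<le> emeasure \<mu> (cube x d)" by (rule reg'[OF x d])
        also have "\<dots> \<le> emeasure \<mu> (cube x l)" using False d by (intro emeasure_mono cube_mono cs) auto
        finally show ?thesis .
      qed
    qed
  next
    case False
    obtain m where m: "emeasure \<mu> \<Omega> = ennreal m" "0 < m" using \<Omega> by (cases "emeasure \<mu> \<Omega>") (auto simp: less_le)
    show ?thesis
    proof (rule that[OF m(2)], intro ballI allI impI, elim conjE)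
      fix x and l :: real
      assume x: "x \<in> \<Omega>" and l: "0 < l" "l \<le> 1"
      have "y = x" if "y \<in> \<Omega>" for y
        using diameter_bounded_bound[OF \<Omega>(2) x that] False by (metis dist_eq_0_iff dual_order.trans not_le order_antisym zero_le_dist)
      then have "\<Omega> \<subseteq> cube x l" using center_in_cube[of l x] l by auto
      then have "emeasure \<mu> \<Omega> \<le> emeasure \<mu> (cube x l)" by (intro emeasure_mono cs)
      moreover have "l powr \<beta> \<le> 1" using l \<beta> by (intro powr_le1) auto
      then have "ennreal (m * l powr \<beta>) \<le> ennreal m" using m by (intro ennreal_leI) (simp add: mult_left_le)
      ultimately show "ennreal (m * l powr \<beta>) \<le> emeasure \<mu> (cube x l)" using m by (metis order_trans)
    qed
  qed
qed

text \<open>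
  For distances at most \<open>\<surd>l\<close> the oscillation of the exponent is of order \<open>1 / ln (1 / l)\<close>, while \<open>ln U\<close> is of
  order \<open>ln (1 / l)\<close>; the product stays bounded. The threshold \<open>1/4\<close> makes \<open>ln (1 / l) > 1\<close>.
\<close>

lemma log_Holder_powr_le:
  fixes a b d l U K \<beta> D :: real
  assumes d: "0 \<le> d" "d \<le> sqrt l" and l: "0 < l" "l \<le> 1/4" and U: "1 \<le> U" "U \<le> K * l powr (- \<beta>)"
    and K: "0 < K" and \<beta>: "0 < \<beta>" and D: "0 \<le> D"
    and lip: "\<bar>a - b\<bar> \<le> D / ln (1 / d)"
  shows "U powr (a - b) \<le> exp (2 * D * (\<bar>ln K\<bar> + \<beta>))"
proof -
  have sq: "sqrt l \<le> 1/2" using l real_sqrt_le_mono[of l "1/4"] by (simp add: real_sqrt_divide)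
  have "1 < ln (4::real)"
  proof -
    have "exp 1 < (4::real)" using exp_le by simp
    then show ?thesis by (metis exp_gt_zero exp_less_cancel_iff exp_ln zero_less_numeral)
  qed
  also have "ln 4 \<le> ln (1 / l)" using l by (subst ln_le_cancel_iff) (auto simp: field_simps)
  finally have L: "1 < ln (1 / l)" .
  have lnU: "0 \<le> ln U" "ln U \<le> \<bar>ln K\<bar> + \<beta> * ln (1 / l)"
  proof -
    have "ln U \<le> ln (K * l powr (- \<beta>))" using U by (subst ln_le_cancel_iff) auto
    also have "\<dots> = ln K + \<beta> * ln (1 / l)" using K l by (simp add: ln_mult ln_powr ln_div)
    finally show "ln U \<le> \<bar>ln K\<bar> + \<beta> * ln (1 / l)" by simp
  qed (use U in simp)
  have "(a - b) * ln U \<le> 2 * D * (\<bar>ln K\<bar> + \<beta>)"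
  proof (cases "d = 0")
    case True
    then have "a = b" using lip by simp
    then show ?thesis using D \<beta> by simp
  next
    case False
    then have d0: "0 < d" using d by simp
    have "ln d \<le> ln (sqrt l)" using d0 d l by (subst ln_le_cancel_iff) auto
    also have "ln (sqrt l) = ln l / 2" using l by (simp add: ln_sqrt)
    finally have ld: "ln (1 / l) / 2 \<le> ln (1 / d)" using d0 l by (simp add: ln_div)
    have "(a - b) * ln U \<le> \<bar>a - b\<bar> * ln U" using lnU by (intro mult_right_mono) auto
    also have "\<dots> \<le> (D / ln (1 / d)) * ln U" using lip lnU by (intro mult_right_mono) auto
    also have "\<dots> \<le> (D / (ln (1 / l) / 2)) * ln U"
      using ld L D lnU by (intro mult_right_mono divide_left_mono) auto
    also have "\<dots> \<le> (D / (ln (1 / l) / 2)) * ((\<bar>ln K\<bar> + \<beta>) * ln (1 / l))"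
    proof (intro mult_left_mono)
      have "\<bar>ln K\<bar> * 1 \<le> \<bar>ln K\<bar> * ln (1 / l)" using L by (intro mult_left_mono) auto
      then show "ln U \<le> (\<bar>ln K\<bar> + \<beta>) * ln (1 / l)" using lnU by (simp add: algebra_simps)
    qed (use D L in auto)
    also have "\<dots> = 2 * D * (\<bar>ln K\<bar> + \<beta>)" using L by (simp add: field_simps)
    finally show ?thesis .
  qed
  then show ?thesis using U by (simp add: powr_def)
qed

section \<open>The maximal function with a variable exponent\<close>

text \<open>
  The role of \<open>P\<close> is played by \<open>\<bar>w f\<bar>\<^sup>p\<close> for a function \<open>f\<close> of norm at most \<open>1\<close>.
\<close>

definition unit_density :: "'a measure \<Rightarrow> 'a set \<Rightarrow> ('a \<Rightarrow> real) \<Rightarrow> bool" where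
  "unit_density M \<Omega> P \<longleftrightarrow> P \<in> borel_measurable M \<and> (\<forall>x. 0 \<le> P x) \<and> (\<forall>x. x \<notin> \<Omega> \<longrightarrow> P x = 0) \<and>
     (\<integral>\<^sup>+x. ennreal (P x) \<partial>M) \<le> 1"

lemma unit_densityD:
  assumes "unit_density M \<Omega> P"
  shows "P \<in> borel_measurable M" "\<And>x. 0 \<le> P x" "\<And>x. x \<notin> \<Omega> \<Longrightarrow> P x = 0" "(\<integral>\<^sup>+x. ennreal (P x) \<partial>M) \<le> 1"
  using assms by (auto simp: unit_density_def)

text \<open>
  The situation after all null sets have been removed: \<open>v\<close> stands for the weight \<open>w\<^sup>q\<close>, positive and finite
  everywhere, and the regularity and Muckenhoupt hypotheses are replaced by the bounds that they imply. The
  function in the last assumption is \<open>w\<^bsup>-p'\<^esup>\<close>.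
\<close>

locale log_Holder_weight =
  fixes \<mu> :: "(real ^ 'n) measure" and \<Omega> :: "(real ^ 'n) set"
    and v s :: "real ^ 'n \<Rightarrow> real" and \<beta> c S D r \<sigma> CA K1 :: real
  assumes sets_borel: "sets borel \<subseteq> sets \<mu>"
    and \<Omega>[measurable]: "\<Omega> \<in> sets \<mu>" and \<Omega>_bounded: "bounded \<Omega>"
    and cubes_finite: "\<forall>x\<in>\<Omega>. \<forall>l>0. emeasure \<mu> (cube x l) < \<infinity>"
    and \<beta>: "0 < \<beta>" and c: "0 < c"
    and cube_lower: "\<And>x l. x \<in> \<Omega> \<Longrightarrow> 0 < l \<Longrightarrow> l \<le> 1 \<Longrightarrow> ennreal (c * l powr \<beta>) \<le> emeasure \<mu> (cube x l)"
    and v[measurable]: "v \<in> borel_measurable \<mu>" and v0: "\<And>x. 0 < v x"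
    and s[measurable]: "s \<in> borel_measurable \<mu>" and s1: "\<And>x. 1 < s x" and sS: "\<And>x. s x \<le> S"
    and D: "0 \<le> D" and log_Holder: "\<And>x y. x \<in> \<Omega> \<Longrightarrow> y \<in> \<Omega> \<Longrightarrow> dist x y \<le> 1/2 \<Longrightarrow> \<bar>s x - s y\<bar> \<le> D / ln (1 / dist x y)"
    and \<sigma>: "1 \<le> \<sigma>" "\<sigma> < r"
    and CA: "0 < CA" and average: "average_bound \<mu> \<Omega> v \<sigma> CA"
    and v_int: "(\<integral>\<^sup>+x\<in>\<Omega>. ennreal (v x) \<partial>\<mu>) < \<infinity>"
    and K1: "0 \<le> K1" and dual_int: "(\<integral>\<^sup>+x\<in>\<Omega>. ennreal (v x powr (- 1 / (s x - 1))) \<partial>\<mu>) \<le> ennreal K1"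
begin

lemma cube_measurable[measurable]: "cube x l \<in> sets \<mu>"
  by (rule cube_sets[OF sets_borel])

lemma cube_pos: "x \<in> \<Omega> \<Longrightarrow> 0 < l \<Longrightarrow> 0 < emeasure \<mu> (cube x l)"
proof -
  assume x: "x \<in> \<Omega>" "0 < l"
  then have "0 < ennreal (c * min l 1 powr \<beta>)" using c by simp
  also have "\<dots> \<le> emeasure \<mu> (cube x (min l 1))" using x by (intro cube_lower) auto
  also have "\<dots> \<le> emeasure \<mu> (cube x l)" by (intro emeasure_mono cube_mono) auto
  finally show ?thesis .
qed

lemma cube_emeasure: "x \<in> \<Omega> \<Longrightarrow> 0 < l \<Longrightarrow> emeasure \<mu> (cube x l) = ennreal (measure \<mu> (cube x l))"
  using cubes_finite by (intro emeasure_eq_ennreal_measure) (metis infinity_ennreal_def less_irrefl)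

lemma cube_measure_pos: "x \<in> \<Omega> \<Longrightarrow> 0 < l \<Longrightarrow> 0 < measure \<mu> (cube x l)"
  using cube_pos[of x l] cube_emeasure[of x l] by simp

text \<open>
  A form of Young's inequality: \<open>y = (P / v)\<^bsup>1/s\<^esup>\<close> is at most \<open>y\<^sup>s v = P\<close> or at most \<open>v\<^bsup>-1/(s-1)\<^esup>\<close>, according to whether
  \<open>y\<^bsup>s-1\<^esup> v\<close> is at least \<open>1\<close>.
\<close>

lemma nn_integral_root_le:
  assumes P: "unit_density \<mu> \<Omega> P"
  shows "(\<integral>\<^sup>+x. ennreal ((P x / v x) powr (1 / s x)) \<partial>\<mu>) \<le> ennreal (1 + K1)"
proof -
  note [measurable] = unit_densityD(1)[OF P]
  note P0 = unit_densityD(2)[OF P] and off = unit_densityD(3)[OF P] and P1 = unit_densityD(4)[OF P]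
  have "(\<integral>\<^sup>+x. ennreal ((P x / v x) powr (1 / s x)) \<partial>\<mu>)
    \<le> (\<integral>\<^sup>+x. ennreal (P x) + ennreal (v x powr (- 1 / (s x - 1))) * indicator \<Omega> x \<partial>\<mu>)"
  proof (rule nn_integral_mono)
    fix x
    show "ennreal ((P x / v x) powr (1 / s x)) \<le> ennreal (P x) + ennreal (v x powr (- 1 / (s x - 1))) * indicator \<Omega> x"
    proof (cases "x \<in> \<Omega> \<and> 0 < P x")
      case True
      define y where "y = (P x / v x) powr (1 / s x)"
      have y: "0 < y" using True v0[of x] by (simp add: y_def)
      have Py: "P x = y powr s x * v x" using True v0[of x] s1[of x] by (simp add: y_def powr_powr)
      have "y \<le> P x + v x powr (- 1 / (s x - 1))"
      proof (cases "1 \<le> y powr (s x - 1) * v x")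
        case True
        have "y \<le> y * (y powr (s x - 1) * v x)" using True y by simp
        also have "\<dots> = P x" using y powr_add[of y 1 "s x - 1"] by (simp add: Py)
        finally show ?thesis using powr_ge_zero[of "v x" "- 1 / (s x - 1)"] by linarith
      next
        case False
        then have "y powr (s x - 1) \<le> 1 / v x" using v0[of x] by (simp add: field_simps)
        then have "(y powr (s x - 1)) powr (1 / (s x - 1)) \<le> (1 / v x) powr (1 / (s x - 1))"
          using s1[of x] by (intro powr_mono2) auto
        also have "(y powr (s x - 1)) powr (1 / (s x - 1)) = y" using s1[of x] y by (simp add: powr_powr)
        also have "(1 / v x) powr (1 / (s x - 1)) = v x powr (- 1 / (s x - 1))"
          using v0[of x] by (simp add: powr_minus_divide powr_divide)
        finally show ?thesis using P0[of x] by simp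
      qed
      then have "ennreal y \<le> ennreal (P x + v x powr (- 1 / (s x - 1)))" by (rule ennreal_leI)
      also have "\<dots> = ennreal (P x) + ennreal (v x powr (- 1 / (s x - 1))) * indicator \<Omega> x"
        using P0[of x] True by (simp add: ennreal_plus)
      finally show ?thesis by (simp add: y_def)
    next
      case False
      then have "P x = 0" using off P0[of x] by force
      then show ?thesis by simp
    qed
  qed
  also have "\<dots> = (\<integral>\<^sup>+x. ennreal (P x) \<partial>\<mu>) + (\<integral>\<^sup>+x\<in>\<Omega>. ennreal (v x powr (- 1 / (s x - 1))) \<partial>\<mu>)"
    by (rule nn_integral_add) measurable
  also have "\<dots> \<le> 1 + ennreal K1" by (intro add_mono P1 dual_int)
  also have "\<dots> = ennreal (1 + K1)" using K1 by (simp add: ennreal_plus)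
  finally show ?thesis .
qed

text \<open>
  If the average \<open>T\<close> of \<open>g = (P / v)\<^bsup>1/s\<^esup>\<close> over a cube is large, the cube is small and the average of
  \<open>(P / v)\<^bsup>\<sigma>/r\<^esup>\<close> with respect to \<open>v \<mu>\<close> is at least \<open>t\<close>. With \<open>U = T / 2\<close>, the values of \<open>g\<close>
  below \<open>U\<close> contribute at most half of the average. Above \<open>U\<close>, since \<open>s > r\<close> on the cube,
  \<open>g = g\<^bsup>s/r\<^esup> g\<^bsup>1-s/r\<^esup> \<le> h U\<^bsup>1-s/r\<^esup>\<close> with \<open>h = (P / v)\<^bsup>1/r\<^esup>\<close>, and the exponent \<open>s\<close> may be evaluated at the
  center by log-Hoelder continuity. This bounds the average of \<open>h\<close> below by a multiple of \<open>U\<^bsup>s/r\<^esup>\<close>.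
\<close>

lemma large_average:
  assumes \<epsilon>: "0 < \<epsilon>"
  shows "\<exists>C>0. \<exists>R>0. \<forall>P x l t I. unit_density \<mu> \<Omega> P \<and> x \<in> \<Omega> \<and> (\<forall>y\<in>\<Omega>. dist x y < \<epsilon> \<longrightarrow> r < s y) \<and>
      0 < l \<and> 1 \<le> t \<and> 0 \<le> I \<and>
      (\<integral>\<^sup>+y\<in>cube x l. ennreal ((P y / v y) powr (1 / s y)) \<partial>\<mu>) = ennreal I \<and>
      C * t powr (r / \<sigma>) < (I / measure \<mu> (cube x l)) powr s x \<longrightarrow>
      l \<le> R \<and> ennreal t * (\<integral>\<^sup>+y\<in>cube x l \<inter> \<Omega>. ennreal (v y) \<partial>\<mu>)
        \<le> (\<integral>\<^sup>+y\<in>cube x l \<inter> \<Omega>. ennreal ((P y / v y) powr (\<sigma> / r) * v y) \<partial>\<mu>)"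
proof -
  define n where "n = real CARD('n)"
  have n: "1 \<le> n" unfolding n_def by (simp add: Suc_leI)
  \<comment> \<open>Points of a cube of side \<open>l \<le> R\<close> are at distance at most \<open>n l / 2\<close>, less than \<open>\<epsilon>\<close> and \<open>\<surd>l\<close>, from its center.\<close>
  define R where "R = min (1/4) (min (1 / n^2) (\<epsilon> / n))"
  define K where "K = (1 + K1) / c"
  define T0 where "T0 = (1 + K1) / (c * R powr \<beta>)"
  define C1 where "C1 = exp (2 * (D / r) * (\<bar>ln K\<bar> + \<beta>))"
  define k where "k = r / \<sigma>"
  \<comment> \<open>The three entries exclude \<open>T \<le> 2\<close>, yield the factor \<open>t\<close>, and exclude \<open>l > R\<close>, respectively.\<close>
  define C where "C = max (2 powr S) (max (2 powr S * (CA * C1 powr \<sigma>) powr k) (max 1 T0 powr S))"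
  have R: "0 < R" "R \<le> 1/4" "R \<le> 1 / n^2" "R \<le> \<epsilon> / n"
    unfolding R_def using n \<epsilon> by (simp_all only: min.cobounded1 min.coboundedI2 min.cobounded2) auto
  have K: "0 < K" using K1 c by (simp add: K_def)
  have C1: "0 < C1" by (simp add: C1_def)
  have r: "1 < r" and k: "1 < k" using \<sigma> by (auto simp: k_def)
  have C: "2 powr S \<le> C" "2 powr S * (CA * C1 powr \<sigma>) powr k \<le> C" "max 1 T0 powr S \<le> C" by (auto simp: C_def)
  have C0: "0 < C" using C(1) by (rule less_le_trans[rotated]) simp
  show ?thesis
  proof (rule exI[of _ C], rule conjI[OF C0], rule exI[of _ R], rule conjI[OF R(1)], intro allI impI, elim conjE)
    fix P x l t and I :: real
    assume P: "unit_density \<mu> \<Omega> P"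
      and x: "x \<in> \<Omega>" and near: "\<forall>y\<in>\<Omega>. dist x y < \<epsilon> \<longrightarrow> r < s y" and l: "0 < l" and t: "1 \<le> t" and I: "0 \<le> I"
      and I_eq: "(\<integral>\<^sup>+y\<in>cube x l. ennreal ((P y / v y) powr (1 / s y)) \<partial>\<mu>) = ennreal I"
      and big: "C * t powr (r / \<sigma>) < (I / measure \<mu> (cube x l)) powr s x"
    note [measurable] = unit_densityD(1)[OF P]
    note P0 = unit_densityD(2)[OF P] and off = unit_densityD(3)[OF P]
    define g where "g y = (P y / v y) powr (1 / s y)" for y
    define h where "h y = (P y / v y) powr (1 / r)" for y
    have [measurable]: "g \<in> borel_measurable \<mu>" "h \<in> borel_measurable \<mu>"
      unfolding g_def[abs_def] h_def[abs_def] by measurable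
    define m where "m = measure \<mu> (cube x l)"
    have m: "0 < m" unfolding m_def by (rule cube_measure_pos[OF x l])
    have em: "emeasure \<mu> (cube x l) = ennreal m" unfolding m_def by (rule cube_emeasure[OF x l])
    define T where "T = I / m"
    have T0': "0 \<le> T" using I m by (simp add: T_def)
    have tk: "1 \<le> t powr k" using t k by (intro ge_one_powr_ge_zero) auto
    have big': "C * t powr k < T powr s x" using big by (simp add: T_def m_def k_def)
    have CT: "C < T powr s x"
    proof -
      have "C * 1 \<le> C * t powr k" using tk C0 by (intro mult_left_mono) auto
      then show ?thesis using big' by simp
    qed
    have I_le: "I \<le> 1 + K1"
    proof -
      have "ennreal I \<le> (\<integral>\<^sup>+y. ennreal ((P y / v y) powr (1 / s y)) \<partial>\<mu>)"
        unfolding I_eq[symmetric] by (intro nn_integral_mono) (simp add: indicator_def)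
      also have "\<dots> \<le> ennreal (1 + K1)" by (rule nn_integral_root_le[OF P])
      finally show ?thesis using K1 by (simp add: ennreal_le_iff del: ennreal_plus)
    qed
    have "l \<le> R"
    proof (rule ccontr)
      assume "\<not> l \<le> R"
      then have Rl: "R \<le> l" by simp
      have "ennreal (c * R powr \<beta>) \<le> emeasure \<mu> (cube x R)" using R by (intro cube_lower x) auto
      also have "\<dots> \<le> emeasure \<mu> (cube x l)" by (intro emeasure_mono cube_mono Rl) auto
      finally have "c * R powr \<beta> \<le> m" using em m by (simp add: ennreal_le_iff)
      then have "T \<le> T0" unfolding T_def T0_def using I_le I R c by (intro frac_le) auto
      then have "T powr s x \<le> max 1 T0 powr s x" using T0' s1[of x] by (intro powr_mono2) auto
      also have "\<dots> \<le> max 1 T0 powr S" using sS[of x] by (intro powr_mono) auto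
      also have "\<dots> \<le> C" by (rule C)
      finally show False using CT by simp
    qed
    define U where "U = T / 2"
    have T2: "2 < T"
    proof (rule ccontr)
      assume "\<not> 2 < T"
      then have "T powr s x \<le> 2 powr s x" using T0' s1[of x] by (intro powr_mono2) auto
      also have "\<dots> \<le> 2 powr S" using sS[of x] by (intro powr_mono) auto
      finally show False using CT C(1) by simp
    qed
    then have U: "1 \<le> U" by (simp add: U_def)
    have U_le: "U \<le> K * l powr (- \<beta>)"
    proof -
      have "ennreal (c * l powr \<beta>) \<le> ennreal m" unfolding em[symmetric] using \<open>l \<le> R\<close> R l by (intro cube_lower x) auto
      then have "c * l powr \<beta> \<le> m" using m by (simp add: ennreal_le_iff)
      then have "T \<le> (1 + K1) / (c * l powr \<beta>)" unfolding T_def using I_le I l c by (intro frac_le) auto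
      also have "\<dots> = K * l powr (- \<beta>)" by (simp add: K_def powr_minus_divide)
      finally show ?thesis using T0' by (simp add: U_def)
    qed
    have closeness: "r < s y \<and> U powr (s x / r - s y / r) \<le> C1" if y: "y \<in> cube x l" "y \<in> \<Omega>" for y
    proof -
      have d: "dist x y \<le> n * l / 2" unfolding n_def by (rule dist_in_cube_le[OF y(1)])
      have "l \<le> \<epsilon> / n" using \<open>l \<le> R\<close> R(4) by (rule order_trans)
      then have nl: "n * l \<le> \<epsilon>" using n by (simp add: field_simps)
      then have "dist x y < \<epsilon>" using d \<epsilon> by linarith
      then have sy: "r < s y" using near y by blast
      have "l \<le> (1 / n)^2" using order_trans[OF \<open>l \<le> R\<close> R(3)] by (simp add: power_divide)
      then have "sqrt l \<le> 1 / n" using n by (intro real_le_lsqrt) (use l in auto)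
      then have "n * sqrt l \<le> 1" using n by (simp add: field_simps)
      then have "n * sqrt l * sqrt l \<le> 1 * sqrt l" using l by (intro mult_right_mono) auto
      then have "n * l \<le> sqrt l" using l by (simp add: mult.assoc)
      then have d': "dist x y \<le> sqrt l / 2" using d by linarith
      have sq: "sqrt l \<le> 1/2" using \<open>l \<le> R\<close> R(2) real_sqrt_le_mono[of l "1/4"] by (simp add: real_sqrt_divide)
      have "\<bar>s x - s y\<bar> \<le> D / ln (1 / dist x y)" using d' sq by (intro log_Holder x y) linarith
      then have "\<bar>s x - s y\<bar> / r \<le> D / ln (1 / dist x y) / r" using r by (intro divide_right_mono) auto
      moreover have "\<bar>s x / r - s y / r\<bar> = \<bar>s x - s y\<bar> / r" using r by (simp add: diff_divide_distrib[symmetric] abs_divide)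
      ultimately have "\<bar>s x / r - s y / r\<bar> \<le> (D / r) / ln (1 / dist x y)" by (simp add: mult.commute)
      moreover have "dist x y \<le> sqrt l" "l \<le> 1/4"
        using d' real_sqrt_ge_zero[of l] l \<open>l \<le> R\<close> R(2) by linarith+
      ultimately have "U powr (s x / r - s y / r) \<le> C1" unfolding C1_def
        using l \<open>l \<le> R\<close> D r \<beta> U U_le K by (intro log_Holder_powr_le[where l=l and d="dist x y"]) auto
      then show ?thesis using sy by blast
    qed
    define B where "B = U powr (s x / r) / C1"
    have B0: "0 \<le> B" using C1 by (simp add: B_def)
    have "ennreal B * emeasure \<mu> (cube x l) \<le> (\<integral>\<^sup>+y\<in>cube x l \<inter> \<Omega>. ennreal (h y) \<partial>\<mu>)"
    proof -
      have Um: "I = U * m + U * m" using m by (simp add: U_def T_def)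
      have "ennreal (U * m) + ennreal (U * m) = ennreal I"
        unfolding Um using U m by (intro ennreal_plus[symmetric]) auto
      also have "\<dots> = (\<integral>\<^sup>+y\<in>cube x l. ennreal (g y) \<partial>\<mu>)" by (simp add: I_eq g_def)
      also have "\<dots> \<le> (\<integral>\<^sup>+y. ennreal U * indicator (cube x l) y +
          ennreal (C1 * U powr (1 - s x / r)) * (ennreal (h y) * indicator (cube x l \<inter> \<Omega>) y) \<partial>\<mu>)"
      proof (rule nn_integral_mono)
        fix y
        show "ennreal (g y) * indicator (cube x l) y \<le> ennreal U * indicator (cube x l) y +
          ennreal (C1 * U powr (1 - s x / r)) * (ennreal (h y) * indicator (cube x l \<inter> \<Omega>) y)"
        proof (cases "y \<in> cube x l \<and> U < g y")
          case True
          then have "0 < g y" using U by simp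
          then have z: "0 < P y / v y" by (metis g_def powr_eq_0_iff less_irrefl P0 v0 divide_nonneg_pos less_le)
          then have y\<Omega>: "y \<in> \<Omega>" using off[of y] by (cases "y \<in> \<Omega>") auto
          note cl = closeness[OF conjunct1[OF True] y\<Omega>]
          have "g y powr (s y / r) = h y"
            using z s1[of y] by (simp add: g_def h_def powr_powr)
          then have "g y = h y * g y powr (1 - s y / r)"
            using \<open>0 < g y\<close> powr_add[of "g y" "s y / r" "1 - s y / r"] by simp
          also have "\<dots> \<le> h y * U powr (1 - s y / r)"
            using True U cl r by (intro mult_left_mono powr_mono2') (auto simp: h_def)
          also have "U powr (1 - s y / r) = U powr (1 - s x / r) * U powr (s x / r - s y / r)"
            using U by (simp add: powr_add[symmetric])
          also have "h y * (U powr (1 - s x / r) * U powr (s x / r - s y / r)) \<le> h y * (U powr (1 - s x / r) * C1)"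
            using cl by (intro mult_left_mono) (auto simp: h_def)
          finally have "ennreal (g y) \<le> ennreal (C1 * U powr (1 - s x / r) * h y)" by (intro ennreal_leI) (simp add: mult_ac)
          also have "\<dots> = ennreal (C1 * U powr (1 - s x / r)) * ennreal (h y)"
            using C1 by (intro ennreal_mult) (auto simp: h_def)
          finally show ?thesis using True y\<Omega> by (simp add: add_increasing)
        next
          case False
          then have "ennreal (g y) * indicator (cube x l) y \<le> ennreal U * indicator (cube x l) y"
            by (auto simp: indicator_def intro: ennreal_leI)
          then show ?thesis by (rule order_trans) simp
        qed
      qed
      also have "\<dots> = ennreal (U * m) + ennreal (C1 * U powr (1 - s x / r)) * (\<integral>\<^sup>+y\<in>cube x l \<inter> \<Omega>. ennreal (h y) \<partial>\<mu>)"
        using U m by (subst nn_integral_add) (auto simp: nn_integral_cmult nn_integral_cmult_indicator em ennreal_mult)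
      finally have le: "ennreal (U * m) \<le> ennreal (C1 * U powr (1 - s x / r)) * (\<integral>\<^sup>+y\<in>cube x l \<inter> \<Omega>. ennreal (h y) \<partial>\<mu>)"
        by (simp add: ennreal_add_left_cancel_le)
      \<comment> \<open>Multiplication by \<open>e\<close> turns the coefficient \<open>C1 U\<^bsup>1-s(x)/r\<^esup>\<close> of the integral into \<open>1\<close>.\<close>
      define e where "e = U powr (s x / r - 1) / C1"
      have e0: "0 \<le> e" using C1 by (simp add: e_def)
      have "ennreal e * ennreal (U * m) \<le> ennreal e * (ennreal (C1 * U powr (1 - s x / r)) * (\<integral>\<^sup>+y\<in>cube x l \<inter> \<Omega>. ennreal (h y) \<partial>\<mu>))"
        by (rule mult_left_mono[OF le]) simp
      also have "\<dots> = ennreal (e * (C1 * U powr (1 - s x / r))) * (\<integral>\<^sup>+y\<in>cube x l \<inter> \<Omega>. ennreal (h y) \<partial>\<mu>)"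
        using e0 C1 by (simp add: ennreal_mult mult.assoc)
      also have "e * (C1 * U powr (1 - s x / r)) = 1"
        using C1 U powr_add[of U "s x / r - 1" "1 - s x / r"] by (simp add: e_def)
      also have "ennreal e * ennreal (U * m) = ennreal (e * U * m)" using e0 U m by (simp add: ennreal_mult[symmetric] mult.assoc)
      also have "e * U = B" using U powr_add[of U "s x / r - 1" 1] by (simp add: e_def B_def)
      finally show ?thesis using B0 m by (simp add: em ennreal_mult)
    qed
    moreover have "h \<in> borel_measurable \<mu>" by measurable
    moreover have "\<forall>y. 0 \<le> h y" by (simp add: h_def)
    ultimately have av: "ennreal (B powr \<sigma>) * (\<integral>\<^sup>+y\<in>cube x l \<inter> \<Omega>. ennreal (v y) \<partial>\<mu>)
       \<le> ennreal CA * (\<integral>\<^sup>+y\<in>cube x l \<inter> \<Omega>. ennreal (h y powr \<sigma> * v y) \<partial>\<mu>)"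
      using average x l B0 unfolding average_bound_def by blast
    have h\<sigma>: "h y powr \<sigma> = (P y / v y) powr (\<sigma> / r)" for y by (simp add: h_def powr_powr)
    have "CA * t \<le> B powr \<sigma>"
    proof -
      have "(CA * C1 powr \<sigma>) powr k * t powr k \<le> C / 2 powr S * t powr k"
        using C(2) by (intro mult_right_mono) (auto simp: field_simps)
      also have "\<dots> \<le> T powr s x / 2 powr S" using big' by (simp add: divide_right_mono less_imp_le)
      also have "\<dots> \<le> T powr s x / 2 powr s x" using sS[of x] by (intro divide_left_mono powr_mono) auto
      also have "\<dots> = U powr s x" using T0' by (simp add: U_def powr_divide)
      finally have "((CA * C1 powr \<sigma>) * t) powr k \<le> U powr s x"
        using CA t by (simp add: powr_mult)
      then have "(((CA * C1 powr \<sigma>) * t) powr k) powr (1/k) \<le> (U powr s x) powr (1/k)"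
        using k by (intro powr_mono2) auto
      then have "CA * C1 powr \<sigma> * t \<le> U powr (s x / r * \<sigma>)"
        using k CA t \<sigma> by (simp add: powr_powr k_def)
      then have "CA * t \<le> U powr (s x / r * \<sigma>) / C1 powr \<sigma>" using C1 by (simp add: field_simps)
      also have "\<dots> = B powr \<sigma>" using U C1 by (simp add: B_def powr_divide powr_powr)
      finally show ?thesis .
    qed
    then have "ennreal (CA * t) * (\<integral>\<^sup>+y\<in>cube x l \<inter> \<Omega>. ennreal (v y) \<partial>\<mu>)
       \<le> ennreal CA * (\<integral>\<^sup>+y\<in>cube x l \<inter> \<Omega>. ennreal (h y powr \<sigma> * v y) \<partial>\<mu>)"
      using av by (meson ennreal_leI mult_right_mono order_trans zero_le)
    then have "ennreal CA * (ennreal t * (\<integral>\<^sup>+y\<in>cube x l \<inter> \<Omega>. ennreal (v y) \<partial>\<mu>))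
       \<le> ennreal CA * (\<integral>\<^sup>+y\<in>cube x l \<inter> \<Omega>. ennreal (h y powr \<sigma> * v y) \<partial>\<mu>)"
      using CA t by (simp add: ennreal_mult mult.assoc)
    then have "ennreal t * (\<integral>\<^sup>+y\<in>cube x l \<inter> \<Omega>. ennreal (v y) \<partial>\<mu>) \<le> (\<integral>\<^sup>+y\<in>cube x l \<inter> \<Omega>. ennreal (h y powr \<sigma> * v y) \<partial>\<mu>)"
      using CA by (simp add: ennreal_mult_le_mult_iff)
    then show "l \<le> R \<and> ennreal t * (\<integral>\<^sup>+y\<in>cube x l \<inter> \<Omega>. ennreal (v y) \<partial>\<mu>)
        \<le> (\<integral>\<^sup>+y\<in>cube x l \<inter> \<Omega>. ennreal ((P y / v y) powr (\<sigma> / r) * v y) \<partial>\<mu>)"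
      using \<open>l \<le> R\<close> unfolding h\<sigma> by blast
  qed
qed

end

lemma less_epowr_imp:
  fixes M :: ennreal
  assumes "0 < q" "0 \<le> \<rho>" "ennreal (\<rho> powr q) < M epowr q"
  shows "ennreal \<rho> < M"
proof (rule ccontr)
  assume "\<not> ennreal \<rho> < M"
  then have le: "M \<le> ennreal \<rho>" by simp
  then obtain m where m: "M = ennreal m" "0 \<le> m" by (cases M) (auto simp: top_unique)
  then have "m \<le> \<rho>" using le assms by (simp add: ennreal_le_iff)
  then have "m powr q \<le> \<rho> powr q" using m assms by (intro powr_mono2) auto
  moreover have "M epowr q = ennreal (m powr q)" using m assms by (auto simp: epowr_def ennreal_eq_0_iff)
  ultimately show False using assms by (simp add: ennreal_le_iff not_less[symmetric] ennreal_less_iff)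
qed

context log_Holder_weight
begin

text \<open>
  The function \<open>f\<close> is the one that corresponds to the density \<open>P\<close>, factored so that Hoelder's inequality applies
  with the constant powers \<open>1 - a\<close> and \<open>a\<close>. The integrand \<open>\<phi>\<close> stands for a power of the maximal function, whose
  measurability is left open; the estimate is proved for the simple functions \<open>\<psi>\<close> below \<open>\<phi>\<close>, by applying the maximal
  theorem to the function \<open>u\<close> with \<open>\<psi> = C u\<^sup>k v\<close>.
\<close>

theorem maximal_modular_bound:
  assumes a: "0 \<le> a" "a < 1" and \<epsilon>: "0 < \<epsilon>"
  shows "\<exists>C>0. \<forall>P f E \<phi>. unit_density \<mu> \<Omega> P \<and>
      (\<forall>x. f x = ((P x / v x) powr (1 / s x)) powr (1 - a) * P x powr a) \<and>
      E \<subseteq> \<Omega> \<and> (\<forall>x\<in>E. \<forall>y\<in>\<Omega>. dist x y < \<epsilon> \<longrightarrow> r < s y) \<and>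
      (\<forall>x. x \<notin> E \<longrightarrow> \<phi> x = 0) \<and>
      (\<forall>x\<in>E. \<phi> x \<le> ennreal (v x) *
        (SUP \<rho>\<in>{0<..}. (\<integral>\<^sup>+y\<in>cube x \<rho>. ennreal (f y) \<partial>\<mu>) / (emeasure \<mu> (cube x \<rho>)) epowr (1 - a)) epowr (s x / (1 - a))) \<longrightarrow>
      (\<integral>\<^sup>+x. \<phi> x \<partial>\<mu>) \<le> ennreal C"
proof -
  define k where "k = r / \<sigma>"
  have k: "1 < k" and k\<sigma>: "\<sigma> * k / r = 1" using \<sigma> by (auto simp: k_def)
  obtain C R :: real where C: "0 < C" "0 < R"
    and large: "\<forall>P x l t I. unit_density \<mu> \<Omega> P \<and> x \<in> \<Omega> \<and> (\<forall>y\<in>\<Omega>. dist x y < \<epsilon> \<longrightarrow> r < s y) \<and>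
      0 < l \<and> 1 \<le> t \<and> 0 \<le> I \<and>
      (\<integral>\<^sup>+y\<in>cube x l. ennreal ((P y / v y) powr (1 / s y)) \<partial>\<mu>) = ennreal I \<and>
      C * t powr (r / \<sigma>) < (I / measure \<mu> (cube x l)) powr s x \<longrightarrow>
      l \<le> R \<and> ennreal t * (\<integral>\<^sup>+y\<in>cube x l \<inter> \<Omega>. ennreal (v y) \<partial>\<mu>)
        \<le> (\<integral>\<^sup>+y\<in>cube x l \<inter> \<Omega>. ennreal ((P y / v y) powr (\<sigma> / r) * v y) \<partial>\<mu>)"
    using large_average[OF \<epsilon>] by (elim exE conjE)
  obtain V where V: "(\<integral>\<^sup>+x\<in>\<Omega>. ennreal (v x) \<partial>\<mu>) = ennreal V" "0 \<le> V"
    using v_int by (cases "(\<integral>\<^sup>+x\<in>\<Omega>. ennreal (v x) \<partial>\<mu>)") auto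
  define Cs where "Cs = strong_type_const CARD('n \<Rightarrow> bool \<times> bool) k"
  have Cs: "0 \<le> Cs" unfolding Cs_def by (rule strong_type_const_nonneg[OF k])
  show ?thesis
  proof (rule exI[of _ "C * (V + Cs) + 1"], rule conjI)
    show "0 < C * (V + Cs) + 1" using C V Cs by (simp add: add_nonneg_pos)
  next
    show "\<forall>P f E \<phi>. unit_density \<mu> \<Omega> P \<and>
      (\<forall>x. f x = ((P x / v x) powr (1 / s x)) powr (1 - a) * P x powr a) \<and>
      E \<subseteq> \<Omega> \<and> (\<forall>x\<in>E. \<forall>y\<in>\<Omega>. dist x y < \<epsilon> \<longrightarrow> r < s y) \<and>
      (\<forall>x. x \<notin> E \<longrightarrow> \<phi> x = 0) \<and>
      (\<forall>x\<in>E. \<phi> x \<le> ennreal (v x) *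
        (SUP \<rho>\<in>{0<..}. (\<integral>\<^sup>+y\<in>cube x \<rho>. ennreal (f y) \<partial>\<mu>) / (emeasure \<mu> (cube x \<rho>)) epowr (1 - a)) epowr (s x / (1 - a))) \<longrightarrow>
      (\<integral>\<^sup>+x. \<phi> x \<partial>\<mu>) \<le> ennreal (C * (V + Cs) + 1)"
    proof (intro allI impI, elim conjE)
      fix P f and E :: "(real ^ 'n) set" and \<phi>
      assume P: "unit_density \<mu> \<Omega> P"
        and f: "\<forall>x. f x = ((P x / v x) powr (1 / s x)) powr (1 - a) * P x powr a"
        and E\<Omega>: "E \<subseteq> \<Omega>" and E_near: "\<forall>x\<in>E. \<forall>y\<in>\<Omega>. dist x y < \<epsilon> \<longrightarrow> r < s y"
        and \<phi>0: "\<forall>x. x \<notin> E \<longrightarrow> \<phi> x = 0"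
        and \<phi>: "\<forall>x\<in>E. \<phi> x \<le> ennreal (v x) *
          (SUP \<rho>\<in>{0<..}. (\<integral>\<^sup>+y\<in>cube x \<rho>. ennreal (f y) \<partial>\<mu>) / (emeasure \<mu> (cube x \<rho>)) epowr (1 - a)) epowr (s x / (1 - a))"
      note \<phi> = bspec[OF \<phi>]
      have E: "x \<in> \<Omega>" "\<forall>y\<in>\<Omega>. dist x y < \<epsilon> \<longrightarrow> r < s y" if "x \<in> E" for x
        using that E\<Omega> E_near by blast+
      note [measurable] = unit_densityD(1)[OF P]
      note P0 = unit_densityD(2)[OF P] and P1 = unit_densityD(4)[OF P]
      define g where "g y = (P y / v y) powr (1 / s y)" for y
      have g[measurable]: "g \<in> borel_measurable \<mu>" unfolding g_def[abs_def] by measurable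
      have g_int: "(\<integral>\<^sup>+y. ennreal (g y) \<partial>\<mu>) \<le> ennreal (1 + K1)"
        unfolding g_def by (rule nn_integral_root_le[OF P])
      define \<nu> where "\<nu> = density \<mu> (\<lambda>x. ennreal (v x) * indicator \<Omega> x)"
      have sets\<nu>[measurable_cong]: "sets \<nu> = sets \<mu>" by (simp add: \<nu>_def)
      have \<nu>_int: "(\<integral>\<^sup>+x. F x \<partial>\<nu>) = (\<integral>\<^sup>+x. (ennreal (v x) * indicator \<Omega> x) * F x \<partial>\<mu>)" if [measurable]: "F \<in> borel_measurable \<mu>" for F
        unfolding \<nu>_def by (rule nn_integral_density) measurable
      define H where "H y = (P y / v y) powr (\<sigma> / r)" for y
      have H[measurable]: "H \<in> borel_measurable \<mu>" unfolding H_def[abs_def] by measurable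
      have \<nu>_cube: "emeasure \<nu> (cube x l) = (\<integral>\<^sup>+y\<in>cube x l \<inter> \<Omega>. ennreal (v y) \<partial>\<mu>)" for x l
        unfolding \<nu>_def by (subst emeasure_density) (auto intro!: nn_integral_cong simp: indicator_def)
      have \<nu>_space: "emeasure \<nu> (space \<nu>) = ennreal V"
        unfolding \<nu>_def V(1)[symmetric] by (subst emeasure_density) (auto intro!: nn_integral_cong)
      have \<nu>_H: "(\<integral>\<^sup>+y\<in>cube x l. ennreal (H y) \<partial>\<nu>) = (\<integral>\<^sup>+y\<in>cube x l \<inter> \<Omega>. ennreal (H y * v y) \<partial>\<mu>)" for x l
        by (subst \<nu>_int) (auto intro!: nn_integral_cong simp: indicator_def H_def ennreal_mult less_imp_le[OF v0] mult.commute)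
      have H_int: "(\<integral>\<^sup>+y. ennreal (H y powr k) \<partial>\<nu>) \<le> 1"
      proof -
        have "(\<integral>\<^sup>+y. ennreal (H y powr k) \<partial>\<nu>) \<le> (\<integral>\<^sup>+y. ennreal (P y) \<partial>\<mu>)"
        proof (subst \<nu>_int, measurable, rule nn_integral_mono)
          fix x
          have "v x * H x powr k = P x" using v0[of x] P0[of x] by (simp add: H_def powr_powr k\<sigma>)
          then show "ennreal (v x) * indicator \<Omega> x * ennreal (H x powr k) \<le> ennreal (P x)"
            using v0[of x] by (simp add: indicator_def ennreal_mult[symmetric])
        qed
        then show ?thesis using P1 by (rule order_trans)
      qed
      have f_int: "(\<integral>\<^sup>+y\<in>cube x l. ennreal (f y) \<partial>\<mu>) \<le> ennreal (I powr (1 - a))"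
        if I: "(\<integral>\<^sup>+y\<in>cube x l. ennreal (g y) \<partial>\<mu>) = ennreal I" "0 \<le> I" for x l I
      proof -
        have "(\<integral>\<^sup>+y. ennreal ((g y * indicator (cube x l) y) powr (1 - a) * P y powr (1 - (1 - a))) \<partial>\<mu>)
          \<le> ennreal (I powr (1 - a) * 1 powr (1 - (1 - a)))"
        proof (rule nn_integral_Holder)
          have "(\<integral>\<^sup>+y. ennreal (g y * indicator (cube x l) y) \<partial>\<mu>) = ennreal I"
            unfolding I(1)[symmetric] by (intro nn_integral_cong) (simp add: indicator_def)
          then show "(\<integral>\<^sup>+y. ennreal (g y * indicator (cube x l) y) \<partial>\<mu>) \<le> ennreal I" by simp
        qed (use a I P0 P1 in \<open>auto simp: g_def\<close>)
        moreover have "(\<integral>\<^sup>+y. ennreal ((g y * indicator (cube x l) y) powr (1 - a) * P y powr (1 - (1 - a))) \<partial>\<mu>)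
          = (\<integral>\<^sup>+y\<in>cube x l. ennreal (f y) \<partial>\<mu>)"
          by (intro nn_integral_cong) (simp add: indicator_def f g_def)
        ultimately show ?thesis by simp
      qed
      have good_cube: "x \<in> \<Omega> \<and> (\<exists>l. 0 < l \<and> l \<le> R \<and> ennreal t * emeasure \<nu> (cube x l) \<le> (\<integral>\<^sup>+y\<in>cube x l. ennreal (H y) \<partial>\<nu>))"
        if t: "1 \<le> t" and big: "ennreal (C * t powr k * v x) < \<phi> x" for x t
      proof -
        have xE: "x \<in> E" using big \<phi>0 by (metis not_less_zero)
        define M where "M = (SUP \<rho>\<in>{0<..}. (\<integral>\<^sup>+y\<in>cube x \<rho>. ennreal (f y) \<partial>\<mu>) / (emeasure \<mu> (cube x \<rho>)) epowr (1 - a))"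
        define q where "q = s x / (1 - a)"
        define L where "L = C * t powr k"
        have L: "0 < L" using C t by (simp add: L_def)
        have q: "0 < q" using a s1[of x] by (simp add: q_def)
        have "ennreal L < M epowr q"
        proof (rule ccontr)
          assume "\<not> ennreal L < M epowr q"
          then have "ennreal (v x) * M epowr q \<le> ennreal (v x) * ennreal L" by (intro mult_left_mono) auto
          also have "\<dots> = ennreal (C * t powr k * v x)" using v0[of x] L by (simp add: L_def ennreal_mult[symmetric] mult.commute)
          finally have "\<phi> x \<le> ennreal (C * t powr k * v x)" using \<phi>[OF xE] unfolding M_def q_def by (rule order_trans[rotated])
          then show False using big by simp
        qed
        moreover have Lq: "(L powr (1/q)) powr q = L" using q L by (simp add: powr_powr)
        ultimately have "ennreal (L powr (1/q)) < M" by - (rule less_epowr_imp[OF q, where M=M], simp_all)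
        then obtain l where l: "0 < l" and l_big: "ennreal (L powr (1/q)) < (\<integral>\<^sup>+y\<in>cube x l. ennreal (f y) \<partial>\<mu>) / (emeasure \<mu> (cube x l)) epowr (1 - a)"
          unfolding M_def less_SUP_iff by (elim bexE) (simp only: greaterThan_iff)
        define m where "m = measure \<mu> (cube x l)"
        have m: "0 < m" unfolding m_def by (rule cube_measure_pos[OF E(1)[OF xE] l])
        have em: "emeasure \<mu> (cube x l) epowr (1 - a) = ennreal (m powr (1 - a))"
          using cube_emeasure[OF E(1)[OF xE] l] m a by (simp add: epowr_def m_def)
        have "(\<integral>\<^sup>+y\<in>cube x l. ennreal (g y) \<partial>\<mu>) \<le> (\<integral>\<^sup>+y. ennreal (g y) \<partial>\<mu>)"
          by (intro nn_integral_mono) (simp add: indicator_def)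
        then have "(\<integral>\<^sup>+y\<in>cube x l. ennreal (g y) \<partial>\<mu>) < \<infinity>"
          using g_int by (metis ennreal_less_top infinity_ennreal_def le_less_trans)
        then obtain I where I: "(\<integral>\<^sup>+y\<in>cube x l. ennreal (g y) \<partial>\<mu>) = ennreal I" "0 \<le> I"
          by (cases "(\<integral>\<^sup>+y\<in>cube x l. ennreal (g y) \<partial>\<mu>)") auto
        have "ennreal (L powr (1/q)) < ennreal (I powr (1 - a)) / ennreal (m powr (1 - a))"
          using l_big f_int[OF I] unfolding em by (meson divide_right_mono_ennreal less_le_trans)
        also have "\<dots> = ennreal ((I / m) powr (1 - a))" using I m by (simp add: divide_ennreal powr_divide)
        finally have "L powr (1/q) < (I / m) powr (1 - a)" by (simp add: ennreal_less_iff)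
        then have "(L powr (1/q)) powr q < ((I / m) powr (1 - a)) powr q" using q by (intro powr_less_mono2) auto
        moreover have "(1 - a) * q = s x" using a by (simp add: q_def)
        ultimately have "L < (I / m) powr s x" unfolding Lq by (simp add: powr_powr)
        then have "l \<le> R \<and> ennreal t * (\<integral>\<^sup>+y\<in>cube x l \<inter> \<Omega>. ennreal (v y) \<partial>\<mu>)
          \<le> (\<integral>\<^sup>+y\<in>cube x l \<inter> \<Omega>. ennreal ((P y / v y) powr (\<sigma> / r) * v y) \<partial>\<mu>)"
          using I E[OF xE] P l t unfolding L_def k_def m_def g_def
          by (intro large[rule_format] conjI) assumption+
        then show ?thesis using l E(1)[OF xE] unfolding \<nu>_cube \<nu>_H unfolding H_def
          by (elim conjE, intro conjI exI[of _ l]) assumption+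
      qed
      have "integral\<^sup>S \<mu> \<psi> \<le> ennreal (C * (V + Cs) + 1)"
        if sf: "simple_function \<mu> \<psi>" and le: "\<psi> \<le> \<phi>" and top: "\<forall>x. \<psi> x < top" for \<psi>
      proof -
        have [measurable]: "\<psi> \<in> borel_measurable \<mu>" using sf by (rule borel_measurable_simple_function)
        define u where "u x = (enn2real (\<psi> x) / (C * v x)) powr (1 / k)" for x
        have u[measurable]: "u \<in> borel_measurable \<mu>" unfolding u_def[abs_def] by measurable
        have u\<psi>: "ennreal (C * u x powr k * v x) = \<psi> x" for x
        proof -
          have "u x powr k = enn2real (\<psi> x) / (C * v x)" using k C v0[of x] by (simp add: u_def powr_powr)
          then show ?thesis using C v0[of x] top by (simp add: ennreal_enn2real)
        qed
        have "(\<integral>\<^sup>+x. ennreal (u x powr k) \<partial>\<nu>) \<le> emeasure \<nu> (space \<nu>) +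
           ennreal (strong_type_const (CARD('n \<Rightarrow> bool \<times> bool)) k) * (\<integral>\<^sup>+x. ennreal (H x powr k) \<partial>\<nu>)"
        proof (rule maximal_strong_type[where B=\<Omega> and R=R])
          show "sets borel \<subseteq> sets \<nu>" using sets_borel by (simp add: sets\<nu>)
          fix x t assume t: "1 \<le> t" "t < u x"
          then have "t powr k < u x powr k" using k by (intro powr_less_mono2) auto
          then have "C * t powr k * v x < C * u x powr k * v x" using C v0[of x] by simp
          then have "ennreal (C * t powr k * v x) < \<psi> x"
            unfolding u\<psi>[symmetric] using C(1) v0[of x] by (subst ennreal_less_iff) (simp_all add: less_imp_le)
          also have "\<psi> x \<le> \<phi> x" using le by (simp add: le_fun_def)
          finally show "x \<in> \<Omega> \<and> (\<exists>l. 0 < l \<and> l \<le> R \<and> ennreal t * emeasure \<nu> (cube x l) \<le> (\<integral>\<^sup>+y\<in>cube x l. ennreal (H y) \<partial>\<nu>))"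
            by (rule good_cube[OF t(1)])
        qed (use \<nu>_space k \<Omega>_bounded in \<open>auto simp: H_def u_def\<close>)
        also have "\<dots> \<le> ennreal V + ennreal Cs * 1"
          unfolding \<nu>_space Cs_def by (intro add_left_mono mult_left_mono H_int) auto
        also have "\<dots> = ennreal (V + Cs)" using V Cs by (simp add: ennreal_plus)
        finally have ub: "(\<integral>\<^sup>+x. ennreal (u x powr k) \<partial>\<nu>) \<le> ennreal (V + Cs)" .
        have "integral\<^sup>S \<mu> \<psi> = (\<integral>\<^sup>+x. \<psi> x \<partial>\<mu>)" by (rule nn_integral_eq_simple_integral[OF sf, symmetric])
        also have "\<dots> = (\<integral>\<^sup>+x. ennreal C * (ennreal (v x) * indicator \<Omega> x * ennreal (u x powr k)) \<partial>\<mu>)"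
        proof (rule nn_integral_cong)
          fix x
          show "\<psi> x = ennreal C * (ennreal (v x) * indicator \<Omega> x * ennreal (u x powr k))"
          proof (cases "x \<in> \<Omega>")
            case True
            then show ?thesis unfolding u\<psi>[of x, symmetric] using C v0[of x] by (simp add: ennreal_mult mult_ac)
          next
            case False
            then have "\<phi> x = 0" using E(1) \<phi>0 by blast
            then have "\<psi> x = 0" using le by (metis le_funD le_zero_eq)
            then show ?thesis using False by simp
          qed
        qed
        also have "\<dots> = ennreal C * (\<integral>\<^sup>+x. ennreal (u x powr k) \<partial>\<nu>)"
          by (subst nn_integral_cmult) (auto simp: \<nu>_int)
        also have "\<dots> \<le> ennreal C * ennreal (V + Cs)" by (intro mult_left_mono ub) simp
        also have "\<dots> \<le> ennreal (C * (V + Cs) + 1)"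
          using C V Cs by (simp add: ennreal_mult[symmetric] ennreal_leI del: ennreal_plus)
        finally show ?thesis .
      qed
      then show "(\<integral>\<^sup>+x. \<phi> x \<partial>\<mu>) \<le> ennreal (C * (V + Cs) + 1)"
        unfolding nn_integral_def_finite by (intro SUP_least) auto
    qed
  qed
qed

end

section \<open>Powers, weights and Luxemburg norms\<close>

text \<open>
  For possibly non-measurable \<open>\<phi>\<close> the integral is a supremum over simple functions, and a simple function
  below \<open>c \<phi>\<close> is \<open>c\<close> times one below \<open>\<phi>\<close>.
\<close>

lemma nn_integral_cmult_le:
  fixes \<phi> :: "'a \<Rightarrow> ennreal"
  assumes c: "0 < c"
  shows "(\<integral>\<^sup>+x. ennreal c * \<phi> x \<partial>M) \<le> ennreal c * (\<integral>\<^sup>+x. \<phi> x \<partial>M)"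
  unfolding nn_integral_def[of M "\<lambda>x. ennreal c * \<phi> x"]
proof (rule SUP_least)
  fix g assume "g \<in> {g. simple_function M g \<and> g \<le> (\<lambda>x. ennreal c * \<phi> x)}"
  then have g: "simple_function M g" and le: "\<And>x. g x \<le> ennreal c * \<phi> x" by (auto simp: le_fun_def)
  have [measurable]: "g \<in> borel_measurable M" using g by (rule borel_measurable_simple_function)
  have cancel: "ennreal c * (ennreal (1 / c) * y) = y" "ennreal (1 / c) * (ennreal c * y) = y" for y
    using c by (simp_all add: mult.assoc[symmetric] ennreal_mult[symmetric])
  have "integral\<^sup>S M g = (\<integral>\<^sup>+x. ennreal c * (ennreal (1 / c) * g x) \<partial>M)"
    unfolding cancel by (rule nn_integral_eq_simple_integral[OF g, symmetric])
  also have "\<dots> = ennreal c * (\<integral>\<^sup>+x. ennreal (1 / c) * g x \<partial>M)" by (rule nn_integral_cmult) measurable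
  also have "\<dots> \<le> ennreal c * (\<integral>\<^sup>+x. \<phi> x \<partial>M)"
  proof (intro mult_left_mono nn_integral_mono)
    fix x
    have "ennreal (1 / c) * g x \<le> ennreal (1 / c) * (ennreal c * \<phi> x)" by (intro mult_left_mono le) simp
    then show "ennreal (1 / c) * g x \<le> \<phi> x" unfolding cancel .
  qed simp
  finally show "integral\<^sup>S M g \<le> ennreal c * (\<integral>\<^sup>+x. \<phi> x \<partial>M)" .
qed

lemma epowr_ennreal: "0 \<le> x \<Longrightarrow> 0 < q \<Longrightarrow> (ennreal x) epowr q = ennreal (x powr q)"
  by (auto simp: epowr_def ennreal_eq_0_iff)

lemma epowr_ennreal_pos: "0 < x \<Longrightarrow> (ennreal x) epowr q = ennreal (x powr q)"
  by (auto simp: epowr_def ennreal_eq_0_iff)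

lemma epowr_mult_ennreal:
  assumes "0 < c" "0 < q"
  shows "(ennreal c * M) epowr q = ennreal (c powr q) * M epowr q"
proof (cases M)
  case (real m)
  then have "(ennreal c * M) epowr q = (ennreal (c * m)) epowr q" using assms by (simp add: ennreal_mult)
  also have "\<dots> = ennreal ((c * m) powr q)" using assms real by (intro epowr_ennreal) auto
  also have "\<dots> = ennreal (c powr q) * M epowr q" using assms real by (simp add: powr_mult ennreal_mult epowr_ennreal)
  finally show ?thesis .
next
  case top
  then show ?thesis using assms by (simp add: epowr_def ennreal_mult_top)
qed

lemma e2ennreal_abs_divide:
  assumes "0 < c"
  shows "e2ennreal \<bar>enn2ereal Z / ereal c\<bar> = ennreal (1 / c) * Z"
proof (cases Z)
  case (real z)
  have "e2ennreal \<bar>enn2ereal (ennreal z) / ereal c\<bar> = ennreal (z / c)"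
    using real assms by (simp add: enn2ereal_ennreal ennreal.rep_eq e2ennreal_ereal)
  then show ?thesis using real assms by (simp add: ennreal_mult[symmetric])
next
  case top
  then show ?thesis using assms by (simp add: ennreal_mult_top)
qed

lemma muckenhoupt_cong_AE:
  assumes A: "muckenhoupt \<mu> \<Omega> \<sigma> v" and eq: "AE x in \<mu>. x \<in> \<Omega> \<longrightarrow> v x = v' x"
    and v': "v' \<in> borel_measurable (restrict_space \<mu> \<Omega>)"
  shows "muckenhoupt \<mu> \<Omega> \<sigma> v'"
proof -
  have w: "weight \<mu> \<Omega> v'"
    using A v' eq unfolding muckenhoupt_def weight_def by auto
  have 1: "(\<integral>\<^sup>+y\<in>cube z l \<inter> \<Omega>. v' y \<partial>\<mu>) = (\<integral>\<^sup>+y\<in>cube z l \<inter> \<Omega>. v y \<partial>\<mu>)" for z l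
    by (rule nn_integral_cong_AE) (use eq in eventually_elim, auto simp: indicator_def)
  have 2: "(\<integral>\<^sup>+y\<in>cube z l \<inter> \<Omega>. (v' y) epowr e \<partial>\<mu>) = (\<integral>\<^sup>+y\<in>cube z l \<inter> \<Omega>. (v y) epowr e \<partial>\<mu>)" for z l e
    by (rule nn_integral_cong_AE) (use eq in eventually_elim, auto simp: indicator_def)
  show ?thesis
  proof (cases "\<sigma> = 1")
    case True
    with A obtain C :: real where C: "0 < C" and AE: "\<And>z l. z \<in> \<Omega> \<Longrightarrow> 0 < l \<Longrightarrow> AE x in \<mu>. x \<in> cube z l \<inter> \<Omega> \<longrightarrow>
          (\<integral>\<^sup>+y\<in>cube z l \<inter> \<Omega>. v y \<partial>\<mu>) / emeasure \<mu> (cube z l) \<le> ennreal C * v x"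
      unfolding muckenhoupt_def by auto
    have "AE x in \<mu>. x \<in> cube z l \<inter> \<Omega> \<longrightarrow>
          (\<integral>\<^sup>+y\<in>cube z l \<inter> \<Omega>. v' y \<partial>\<mu>) / emeasure \<mu> (cube z l) \<le> ennreal C * v' x" if "z \<in> \<Omega>" "0 < l" for z l
      using AE[OF that] eq unfolding 1 by eventually_elim auto
    then show ?thesis using True w C unfolding muckenhoupt_def by auto
  next
    case False
    then show ?thesis using A w unfolding muckenhoupt_def 1 2 by simp
  qed
qed

text \<open>
  A bound between Luxemburg norms is a bound between modulars at the unit level.
\<close>

lemma lux_norm_le_mult:
  assumes K: "0 < K"
    and le: "\<And>t. 0 < t \<Longrightarrow> modular \<mu> p \<Omega> (\<lambda>x. f x / ereal t) \<le> 1 \<Longrightarrow> modular \<mu> q E (\<lambda>x. g x / ereal (K * t)) \<le> 1"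
  shows "lux_norm \<mu> q E g \<le> ennreal K * lux_norm \<mu> p \<Omega> f"
proof -
  have cancel: "ennreal K * (ennreal (1 / K) * y) = y" "ennreal (1 / K) * (ennreal K * y) = y" for y
    using K by (simp_all add: mult.assoc[symmetric] ennreal_mult[symmetric])
  have "ennreal (1 / K) * lux_norm \<mu> q E g \<le> lux_norm \<mu> p \<Omega> f"
    unfolding lux_norm_def[of \<mu> p]
  proof (rule Inf_greatest, clarify)
    fix t :: real assume t: "0 < t" "modular \<mu> p \<Omega> (\<lambda>x. f x / ereal t) \<le> 1"
    have "lux_norm \<mu> q E g \<le> ennreal (K * t)"
      unfolding lux_norm_def using le[OF t] K t by (intro Inf_lower) auto
    also have "\<dots> = ennreal K * ennreal t" using K t by (intro ennreal_mult) auto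
    finally have "ennreal (1 / K) * lux_norm \<mu> q E g \<le> ennreal (1 / K) * (ennreal K * ennreal t)"
      by (rule mult_left_mono) simp
    then show "ennreal (1 / K) * lux_norm \<mu> q E g \<le> ennreal t" unfolding cancel .
  qed
  then have "ennreal K * (ennreal (1 / K) * lux_norm \<mu> q E g) \<le> ennreal K * lux_norm \<mu> p \<Omega> f"
    by (rule mult_left_mono) simp
  then show ?thesis unfolding cancel .
qed

lemma lux_norm_null_set:
  assumes \<Omega>: "\<Omega> \<in> null_sets \<mu>" and E: "E \<subseteq> \<Omega>"
  shows "lux_norm \<mu> q E g = 0"
proof -
  have m: "modular \<mu> q E h = 0" for h
  proof -
    have "modular \<mu> q E h = (\<integral>\<^sup>+x. 0 \<partial>\<mu>)" unfolding modular_def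
      by (rule nn_integral_cong_AE) (use AE_not_in[OF \<Omega>] E in \<open>auto elim!: eventually_mono simp: indicator_def\<close>)
    then show ?thesis by simp
  qed
  have "lux_norm \<mu> q E g \<le> 0 + ennreal e" if "0 < e" for e
    unfolding lux_norm_def m using that by (auto intro!: Inf_lower)
  then show ?thesis using ennreal_le_epsilon[of 0 "lux_norm \<mu> q E g"] by simp
qed

section \<open>Boundedness of the fractional maximal operator\<close>

theorem theorem1p6:
  fixes \<mu> :: "(real ^ 'n) measure" and \<Omega> :: "(real ^ 'n) set"
    and \<alpha> \<beta> r \<delta> \<epsilon>0 :: real
    and p p' q s :: "real ^ 'n \<Rightarrow> real"
    and w :: "real ^ 'n \<Rightarrow> ennreal"
  assumes "borel_regular \<mu>"
    and "bounded \<Omega>" and "\<Omega> \<in> sets \<mu>"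
    and cubes_finite: "\<forall>x\<in>\<Omega>. \<forall>l>0. emeasure \<mu> (cube x l) < \<infinity>"
    and "\<beta> > 0" and "lower_ahlfors_regular \<mu> \<beta> \<Omega>"
    and "0 \<le> \<alpha>" and "\<alpha> < \<beta>"
    and "exponent \<mu> \<Omega> p" and "log_Holder_continuous \<Omega> p"
    and "1 < (INF x\<in>\<Omega>. ereal (p x))"
    and "(SUP x\<in>\<Omega>. ereal (p x)) < (if \<alpha> = 0 then \<infinity> else ereal (\<beta> / \<alpha>))"
    and "\<forall>x\<in>\<Omega>. 1 / p x + 1 / p' x = 1"
    and "\<forall>x\<in>\<Omega>. 1 / q x = 1 / p x - \<alpha> / \<beta>"
    and "\<forall>x\<in>\<Omega>. s x = 1 + q x / p' x"
    and "1 < r" and "ereal r < (SUP x\<in>\<Omega>. ereal (s x))"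
    and "weight \<mu> \<Omega> w"
    and "0 < \<delta>" and "\<delta> \<le> r - 1"
    and "muckenhoupt \<mu> \<Omega> (r - \<delta>) (\<lambda>x. (w x) epowr (q x))"
    and "\<epsilon>0 > 0"
    and "(\<integral>\<^sup>+x\<in>\<Omega> - inner_superlevel \<Omega> s r \<epsilon>0. (w x) epowr (- p' x) \<partial>\<mu>) < \<infinity>"
  shows "\<forall>\<epsilon>. 0 < \<epsilon> \<and> \<epsilon> \<le> \<epsilon>0 \<longrightarrow>
    (\<exists>C::real. C > 0 \<and>
      (\<forall>f :: real ^ 'n \<Rightarrow> ereal.
        (\<forall>x. x \<notin> \<Omega> \<longrightarrow> f x = 0) \<and> (\<lambda>x. enn2ereal (w x) * f x) \<in> Lp \<mu> p \<Omega> \<longrightarrow>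
        lux_norm \<mu> q (inner_superlevel \<Omega> s r \<epsilon>) (\<lambda>x. enn2ereal (w x * frac_maximal \<mu> \<beta> \<alpha> f x))
          \<le> ennreal C * lux_norm \<mu> p \<Omega> (\<lambda>x. enn2ereal (w x) * f x)))"
proof (intro allI impI, elim conjE)
  fix \<epsilon> :: real assume \<epsilon>: "0 < \<epsilon>"
  let ?E = "inner_superlevel \<Omega> s r \<epsilon>"
  have E_sub: "inner_superlevel \<Omega> s r e \<subseteq> \<Omega>" for e by (auto simp: inner_superlevel_def superlevel_def)
  note [measurable] = \<open>\<Omega> \<in> sets \<mu>\<close>
  have sets_borel: "sets borel \<subseteq> sets \<mu>" and space: "space \<mu> = UNIV"
    using assms(1) by (auto simp: borel_regular_def)
  show "\<exists>C::real. C > 0 \<and>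
      (\<forall>f :: real ^ 'n \<Rightarrow> ereal.
        (\<forall>x. x \<notin> \<Omega> \<longrightarrow> f x = 0) \<and> (\<lambda>x. enn2ereal (w x) * f x) \<in> Lp \<mu> p \<Omega> \<longrightarrow>
        lux_norm \<mu> q ?E (\<lambda>x. enn2ereal (w x * frac_maximal \<mu> \<beta> \<alpha> f x))
          \<le> ennreal C * lux_norm \<mu> p \<Omega> (\<lambda>x. enn2ereal (w x) * f x))"
  proof (cases "emeasure \<mu> \<Omega> = 0")
    case True
    then have "lux_norm \<mu> q ?E g = 0" for g
      by (intro lux_norm_null_set[OF _ E_sub]) (auto simp: null_sets_def)
    then show ?thesis by (intro exI[of _ 1]) simp
  next
    case \<mu>\<Omega>: False
    define a where "a = \<alpha> / \<beta>"
    have a: "0 \<le> a" "a < 1" using assms by (auto simp: a_def)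
    obtain z where z: "z \<in> \<Omega>" using \<mu>\<Omega> by (metis emeasure_empty ex_in_conv)
    obtain pm where pm: "1 < pm" "\<And>x. x \<in> \<Omega> \<Longrightarrow> pm \<le> p x"
    proof -
      obtain pm where "ereal 1 < ereal pm" "ereal pm < (INF x\<in>\<Omega>. ereal (p x))"
        using ereal_dense2[OF assms(11)[unfolded one_ereal_def]] by blast
      moreover from this(2) have "pm \<le> p x" if "x \<in> \<Omega>" for x
        using INF_lower[OF that, of "\<lambda>x. ereal (p x)"] by (metis ereal_less_eq(3) less_imp_le order_trans)
      ultimately show ?thesis using that by simp
    qed
    obtain pp where pp: "\<And>x. x \<in> \<Omega> \<Longrightarrow> p x \<le> pp" "a * pp < 1"
    proof -
      obtain pp where pp: "(SUP x\<in>\<Omega>. ereal (p x)) < ereal pp" "ereal pp < (if \<alpha> = 0 then \<infinity> else ereal (\<beta> / \<alpha>))"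
        using ereal_dense2[OF assms(12)] by blast
      have "p x \<le> pp" if "x \<in> \<Omega>" for x
        using SUP_upper[OF that, of "\<lambda>x. ereal (p x)"] pp(1) by (metis ereal_less_eq(3) less_imp_le order_trans)
      moreover have "a * pp < 1"
      proof (cases "\<alpha> = 0")
        case False
        then have "pp < \<beta> / \<alpha>" using pp(2) by simp
        then show ?thesis using False assms by (simp add: a_def field_simps)
      qed (simp add: a_def)
      ultimately show ?thesis using that by blast
    qed
    have pm_pp: "pm \<le> pp" using pm(2)[OF z] pp(1)[OF z] by simp
    define b where "b = 1 / pp - a"
    have b: "0 < b" using pm pm_pp pp(2) by (simp add: b_def field_simps)

    \<comment> \<open>Extending the exponents to the whole space, within the same bounds, makes them measurable for \<open>\<mu>\<close>.\<close>
    define p1 where "p1 x = (if x \<in> \<Omega> then p x else pm)" for x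
    have p1m[measurable]: "p1 \<in> borel_measurable \<mu>"
      using assms(9) unfolding exponent_def p1_def[abs_def]
      by (subst (asm) measurable_restrict_space_iff[where c=pm]) (auto simp: space)
    have p1: "pm \<le> p1 x" "p1 x \<le> pp" for x using pm pp pm_pp by (auto simp: p1_def)
    have p1_gt: "1 < p1 x" for x using p1(1)[of x] pm(1) by simp
    define q1 where "q1 x = 1 / (1 / p1 x - a)" for x
    have q1m[measurable]: "q1 \<in> borel_measurable \<mu>" unfolding q1_def[abs_def] by measurable
    have inv_q1: "1 / q1 x = 1 / p1 x - a" for x by (simp add: q1_def)
    have inv_q1_ge: "b \<le> 1 / q1 x" for x
    proof -
      have "1 / pp \<le> 1 / p1 x" using p1[of x] p1_gt[of x] by (intro divide_left_mono) auto
      then show ?thesis by (simp add: inv_q1 b_def)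
    qed
    have q1_pos: "0 < q1 x" for x using inv_q1_ge[of x] b by (metis less_le_trans zero_less_divide_1_iff)
    have q1_le: "q1 x \<le> 1 / b" for x using inv_q1_ge[of x] b q1_pos[of x] by (simp add: field_simps)
    have q1_gt: "1 < q1 x" for x
    proof -
      have "1 / q1 x \<le> 1 / p1 x" using a by (simp add: inv_q1)
      also have "\<dots> < 1" using p1_gt[of x] by simp
      finally show ?thesis using q1_pos[of x] by simp
    qed
    have q_eq: "q x = q1 x" if "x \<in> \<Omega>" for x
    proof -
      have "1 / q x = 1 / q1 x" using assms(14) that by (simp add: inv_q1 p1_def a_def)
      then show ?thesis by simp
    qed
    define s1 where "s1 x = (1 - a) * q1 x" for x
    have s1m[measurable]: "s1 \<in> borel_measurable \<mu>" unfolding s1_def[abs_def] by measurable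
    have s1_alt: "s1 x = 1 + q1 x * (1 - 1 / p1 x)" for x
    proof -
      have "1 / p1 x = 1 / q1 x + a" by (simp add: inv_q1)
      then have "q1 x * (1 - 1 / p1 x) = q1 x * (1 - a) - 1" using q1_pos[of x] by (simp add: algebra_simps)
      then show ?thesis by (simp add: s1_def)
    qed
    have s1_gt: "1 < s1 x" for x using q1_pos[of x] p1_gt[of x] by (simp add: s1_alt)
    have inv_p': "1 / p' x = 1 - 1 / p1 x" if "x \<in> \<Omega>" for x
      using assms(13) that by (simp add: p1_def algebra_simps)
    have s_eq: "s x = s1 x" if "x \<in> \<Omega>" for x
    proof -
      have "s x = 1 + q1 x * (1 / p' x)" using assms(15) that q_eq[OF that] by simp
      then show ?thesis by (simp add: inv_p'[OF that] s1_alt)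
    qed

    define good where "good x \<longleftrightarrow> 0 < w x \<and> w x < \<infinity>" for x
    \<comment> \<open>A real version of the weight, positive everywhere, that agrees with \<open>w\<close> almost everywhere on \<open>\<Omega>\<close>.\<close>
    define w1 where "w1 x = (if x \<in> \<Omega> \<and> good x then enn2real (w x) else 1)" for x
    have w1m[measurable]: "w1 \<in> borel_measurable \<mu>"
    proof -
      have "(\<lambda>x. if x \<in> \<Omega> then w x else 1) \<in> borel_measurable \<mu>"
        using assms(18) unfolding weight_def
        by (subst (asm) measurable_restrict_space_iff[where c=1]) (auto simp: space)
      then have "(\<lambda>x. if 0 < (if x \<in> \<Omega> then w x else 1) \<and> (if x \<in> \<Omega> then w x else 1) < \<infinity>
          then enn2real (if x \<in> \<Omega> then w x else 1) else 1) \<in> borel_measurable \<mu>"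
        by measurable
      also have "(\<lambda>x. if 0 < (if x \<in> \<Omega> then w x else 1) \<and> (if x \<in> \<Omega> then w x else 1) < \<infinity>
          then enn2real (if x \<in> \<Omega> then w x else 1) else 1) = w1"
        by (auto simp: fun_eq_iff w1_def good_def)
      finally show ?thesis .
    qed
    have w1_pos: "0 < w1 x" for x
      by (auto simp: w1_def good_def enn2real_positive_iff)
    have w_eq: "w x = ennreal (w1 x)" if "x \<in> \<Omega>" "good x" for x
      using that by (auto simp: w1_def good_def)
    have good_AE: "AE x in \<mu>. x \<in> \<Omega> \<longrightarrow> good x"
      using assms(18) by (simp add: weight_def good_def)
    define v where "v x = w1 x powr q1 x" for x
    have vm[measurable]: "v \<in> borel_measurable \<mu>" unfolding v_def[abs_def] by measurable
    have v_pos: "0 < v x" for x using w1_pos[of x] by (simp add: v_def)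
    have v_eq: "(w x) epowr (q x) = ennreal (v x)" if "x \<in> \<Omega>" "good x" for x
      using that w1_pos[of x] by (simp add: w_eq q_eq v_def epowr_ennreal_pos)

    define \<sigma> where "\<sigma> = r - \<delta>"
    have \<sigma>: "1 \<le> \<sigma>" "\<sigma> < r" using assms by (auto simp: \<sigma>_def)
    have A: "muckenhoupt \<mu> \<Omega> \<sigma> (\<lambda>x. ennreal (v x))"
      unfolding \<sigma>_def
    proof (rule muckenhoupt_cong_AE[OF assms(21)])
      show "AE x in \<mu>. x \<in> \<Omega> \<longrightarrow> (w x) epowr (q x) = ennreal (v x)"
        using good_AE v_eq by (auto elim!: eventually_mono)
    qed (auto intro: measurable_restrict_space1)
    note integrable = muckenhoupt_integrable[OF sets_borel \<open>\<Omega> \<in> sets \<mu>\<close> \<open>bounded \<Omega>\<close> cubes_finite vm v_pos \<sigma>(1) A \<mu>\<Omega>]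
    obtain CA where CA: "0 < CA" and average: "average_bound \<mu> \<Omega> v \<sigma> CA"
      using muckenhoupt_average[OF sets_borel \<open>\<Omega> \<in> sets \<mu>\<close> cubes_finite vm v_pos \<sigma>(1) A] .
    obtain c where c: "0 < c" and cube_lower: "\<forall>x\<in>\<Omega>. \<forall>l. 0 < l \<and> l \<le> 1 \<longrightarrow> ennreal (c * l powr \<beta>) \<le> emeasure \<mu> (cube x l)"
      using lower_ahlfors_regular_unit[OF sets_borel \<open>\<Omega> \<in> sets \<mu>\<close> \<open>bounded \<Omega>\<close> \<mu>\<Omega> integrable(1) \<open>\<beta> > 0\<close> assms(6)] .

    obtain Cp where Cp: "0 < Cp" "\<forall>x\<in>\<Omega>. \<forall>y\<in>\<Omega>. dist x y \<le> 1 / 2 \<longrightarrow> \<bar>p x - p y\<bar> \<le> Cp / ln (1 / dist x y)"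
      using assms(10) by (auto simp: log_Holder_continuous_def)
    define L where "L = (1 - a) / b\<^sup>2"
    have L: "0 \<le> L" using a by (simp add: L_def)
    have s1_diff: "\<bar>s1 x - s1 y\<bar> \<le> L * \<bar>p1 x - p1 y\<bar>" for x y
    proof -
      have "s1 x - s1 y = (1 - a) * (q1 x * q1 y) * (1 / q1 y - 1 / q1 x)"
        using q1_pos[of x] q1_pos[of y] by (simp add: s1_def field_simps)
      also have "1 / q1 y - 1 / q1 x = (p1 x - p1 y) / (p1 x * p1 y)"
        using p1_gt[of x] p1_gt[of y] by (simp add: inv_q1 field_simps)
      finally have "\<bar>s1 x - s1 y\<bar> = (1 - a) * (q1 x * q1 y) * (\<bar>p1 x - p1 y\<bar> / (p1 x * p1 y))"
        using a q1_pos[of x] q1_pos[of y] p1_gt[of x] p1_gt[of y] by (simp add: abs_mult)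
      also have "\<dots> \<le> (1 - a) * (1 / b * (1 / b)) * (\<bar>p1 x - p1 y\<bar> / 1)"
      proof (intro mult_mono mult_left_mono divide_left_mono)
        show "1 \<le> p1 x * p1 y" using p1_gt[of x] p1_gt[of y] mult_mono[of 1 "p1 x" 1 "p1 y"] by simp
      qed (use a b q1_pos[of x] q1_pos[of y] q1_le[of x] q1_le[of y] p1_gt[of x] p1_gt[of y] in auto)
      finally show ?thesis by (simp add: L_def power2_eq_square)
    qed
    have log_Holder: "\<bar>s1 x - s1 y\<bar> \<le> (L * Cp) / ln (1 / dist x y)" if "x \<in> \<Omega>" "y \<in> \<Omega>" "dist x y \<le> 1/2" for x y
    proof -
      have "\<bar>s1 x - s1 y\<bar> \<le> L * \<bar>p1 x - p1 y\<bar>" by (rule s1_diff)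
      also have "\<dots> \<le> L * (Cp / ln (1 / dist x y))" using Cp(2) that L by (intro mult_left_mono) (auto simp: p1_def)
      finally show ?thesis by simp
    qed

    \<comment> \<open>This is \<open>q / (s - 1) = p'\<close>.\<close>
    have dual: "v x powr (- 1 / (s1 x - 1)) = w1 x powr (- p' x)" if "x \<in> \<Omega>" for x
    proof -
      have pos: "0 < 1 - 1 / p1 x" using p1_gt[of x] by simp
      have "p' x = 1 / (1 - 1 / p1 x)" using inv_p'[OF that] by (metis div_by_1 divide_divide_eq_right mult_1 )
      moreover have "q1 x * (- 1 / (s1 x - 1)) = - (1 / (1 - 1 / p1 x))"
        using q1_pos[of x] pos by (simp add: s1_alt)
      ultimately show ?thesis by (simp only: v_def powr_powr)
    qed
    have "(\<integral>\<^sup>+x\<in>\<Omega>. ennreal (v x powr (- 1 / (s1 x - 1))) \<partial>\<mu>) < \<infinity>"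
    proof -
      let ?E0 = "inner_superlevel \<Omega> s r \<epsilon>0"
      have [measurable]: "?E0 \<in> sets \<mu>"
      proof -
        have "superlevel \<Omega> s r = {x\<in>space \<mu>. x \<in> \<Omega> \<and> r < s1 x}" by (auto simp: superlevel_def s_eq space)
        also have "\<dots> \<in> sets \<mu>" by measurable
        finally have "superlevel \<Omega> s r \<in> sets \<mu>" .
        moreover have "(\<Union>x\<in>\<Omega> - superlevel \<Omega> s r. ball x \<epsilon>0) \<in> sets \<mu>"
          using sets_borel borel_open[of "\<Union>x\<in>\<Omega> - superlevel \<Omega> s r. ball x \<epsilon>0"] by blast
        ultimately show ?thesis unfolding inner_superlevel_def by (rule sets.Diff)
      qed
      have "(\<integral>\<^sup>+x\<in>\<Omega>. ennreal (v x powr (- 1 / (s1 x - 1))) \<partial>\<mu>)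
        = (\<integral>\<^sup>+x. ennreal (v x powr (- 1 / (s1 x - 1))) * indicator (\<Omega> - ?E0) x + ennreal (v x powr (- 1 / (s1 x - 1))) * indicator ?E0 x \<partial>\<mu>)"
        using E_sub[of \<epsilon>0] by (intro nn_integral_cong) (auto simp: indicator_def)
      also have "\<dots> = (\<integral>\<^sup>+x\<in>\<Omega> - ?E0. ennreal (v x powr (- 1 / (s1 x - 1))) \<partial>\<mu>) + (\<integral>\<^sup>+x\<in>?E0. ennreal (v x powr (- 1 / (s1 x - 1))) \<partial>\<mu>)"
        by (rule nn_integral_add) measurable
      also have "(\<integral>\<^sup>+x\<in>\<Omega> - ?E0. ennreal (v x powr (- 1 / (s1 x - 1))) \<partial>\<mu>) = (\<integral>\<^sup>+x\<in>\<Omega> - ?E0. (w x) epowr (- p' x) \<partial>\<mu>)"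
      proof (rule nn_integral_cong_AE, use good_AE in eventually_elim)
        case (elim x)
        then show ?case using w1_pos[of x] dual[of x] by (auto simp: indicator_def w_eq epowr_ennreal_pos)
      qed
      finally have eq: "(\<integral>\<^sup>+x\<in>\<Omega>. ennreal (v x powr (- 1 / (s1 x - 1))) \<partial>\<mu>)
        = (\<integral>\<^sup>+x\<in>\<Omega> - ?E0. (w x) epowr (- p' x) \<partial>\<mu>) + (\<integral>\<^sup>+x\<in>?E0. ennreal (v x powr (- 1 / (s1 x - 1))) \<partial>\<mu>)" .
      have "(\<integral>\<^sup>+x\<in>?E0. ennreal (v x powr (- 1 / (s1 x - 1))) \<partial>\<mu>) < \<infinity>"
        by (rule integrable(3)[OF \<sigma>(2) E_sub]) (auto simp: inner_superlevel_def superlevel_def s_eq)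
      then show ?thesis unfolding eq using assms(23) by simp
    qed
    then obtain K1 where K1: "0 \<le> K1" "(\<integral>\<^sup>+x\<in>\<Omega>. ennreal (v x powr (- 1 / (s1 x - 1))) \<partial>\<mu>) \<le> ennreal K1"
      by (cases "(\<integral>\<^sup>+x\<in>\<Omega>. ennreal (v x powr (- 1 / (s1 x - 1))) \<partial>\<mu>)") auto

    interpret log_Holder_weight \<mu> \<Omega> v s1 \<beta> c "(1 - a) / b" "L * Cp" r \<sigma> CA K1
    proof
      show "s1 x \<le> (1 - a) / b" for x
        using mult_left_mono[OF q1_le[of x], of "1 - a"] a by (simp add: s1_def)
      show "ennreal (c * l powr \<beta>) \<le> emeasure \<mu> (cube x l)" if "x \<in> \<Omega>" "0 < l" "l \<le> 1" for x l
        using cube_lower that by blast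
    qed (fact sets_borel \<open>\<Omega> \<in> sets \<mu>\<close> \<open>bounded \<Omega>\<close> cubes_finite \<open>\<beta> > 0\<close> c vm v_pos s1m s1_gt log_Holder \<sigma> CA average integrable(2) K1
        | use L Cp in simp)+
    obtain C0 where C0: "0 < C0" and bound: "\<forall>P f E \<phi>. unit_density \<mu> \<Omega> P \<and>
      (\<forall>x. f x = ((P x / v x) powr (1 / s1 x)) powr (1 - a) * P x powr a) \<and>
      E \<subseteq> \<Omega> \<and> (\<forall>x\<in>E. \<forall>y\<in>\<Omega>. dist x y < \<epsilon> \<longrightarrow> r < s1 y) \<and>
      (\<forall>x. x \<notin> E \<longrightarrow> \<phi> x = 0) \<and>
      (\<forall>x\<in>E. \<phi> x \<le> ennreal (v x) *
        (SUP \<rho>\<in>{0<..}. (\<integral>\<^sup>+y\<in>cube x \<rho>. ennreal (f y) \<partial>\<mu>) / (emeasure \<mu> (cube x \<rho>)) epowr (1 - a)) epowr (s1 x / (1 - a))) \<longrightarrow>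
      (\<integral>\<^sup>+x. \<phi> x \<partial>\<mu>) \<le> ennreal C0"
      using maximal_modular_bound[OF a \<epsilon>] by (elim exE conjE)
    define K where "K = max 1 C0"
    have K: "1 \<le> K" "C0 \<le> K" by (auto simp: K_def)

    have main: "modular \<mu> q ?E (\<lambda>x. enn2ereal (w x * frac_maximal \<mu> \<beta> \<alpha> f x) / ereal (K * t)) \<le> 1"
      if f0: "\<forall>x. x \<notin> \<Omega> \<longrightarrow> f x = 0" and Lp: "(\<lambda>x. enn2ereal (w x) * f x) \<in> Lp \<mu> p \<Omega>"
        and t: "0 < t" and unit: "modular \<mu> p \<Omega> (\<lambda>x. enn2ereal (w x) * f x / ereal t) \<le> 1" for f t
    proof -
      define X where "X x = e2ennreal \<bar>enn2ereal (w x) * f x / ereal t\<bar>" for x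
      have [measurable]: "(\<lambda>x. enn2ereal (w x) * f x) \<in> borel_measurable \<mu>" using Lp by (simp add: Lp_def)
      have Xm[measurable]: "X \<in> borel_measurable \<mu>" unfolding X_def[abs_def] by measurable
      define P where "P x = (if x \<in> \<Omega> then enn2real (X x) powr p1 x else 0)" for x
      define F where "F x = ((P x / v x) powr (1 / s1 x)) powr (1 - a) * P x powr a" for x
      have Pm[measurable]: "P \<in> borel_measurable \<mu>" unfolding P_def[abs_def] by measurable
      have X_epowr: "(X x) epowr (p1 x) = (if X x = \<infinity> then \<infinity> else ennreal (enn2real (X x) powr p1 x))" for x
        using p1_gt[of x] by (auto simp: epowr_def)
      have X_int: "(\<integral>\<^sup>+x\<in>\<Omega>. (X x) epowr (p1 x) \<partial>\<mu>) \<le> 1"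
      proof -
        have "modular \<mu> p \<Omega> (\<lambda>x. enn2ereal (w x) * f x / ereal t) = (\<integral>\<^sup>+x\<in>\<Omega>. (X x) epowr (p1 x) \<partial>\<mu>)"
          unfolding modular_def X_def by (intro nn_integral_cong) (auto simp: indicator_def p1_def)
        then show ?thesis using unit by simp
      qed
      have P: "unit_density \<mu> \<Omega> P"
        unfolding unit_density_def
      proof (intro conjI allI impI)
        have "(\<integral>\<^sup>+x. ennreal (P x) \<partial>\<mu>) \<le> (\<integral>\<^sup>+x\<in>\<Omega>. (X x) epowr (p1 x) \<partial>\<mu>)"
          unfolding X_epowr by (intro nn_integral_mono) (auto simp: P_def indicator_def)
        then show "(\<integral>\<^sup>+x. ennreal (P x) \<partial>\<mu>) \<le> 1" using X_int by (rule order_trans)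
      qed (auto simp: P_def Pm)
      have X_fin: "AE x in \<mu>. x \<in> \<Omega> \<longrightarrow> X x \<noteq> \<infinity>"
      proof -
        have m: "(\<lambda>x. (X x) epowr (p1 x) * indicator \<Omega> x) \<in> borel_measurable \<mu>"
          unfolding X_epowr by measurable
        have "(\<integral>\<^sup>+x\<in>\<Omega>. (X x) epowr (p1 x) \<partial>\<mu>) \<noteq> \<infinity>" using X_int by (metis ennreal_one_neq_top infinity_ennreal_def top_unique)
        from nn_integral_PInf_AE[OF m this] show ?thesis
          by (rule eventually_mono) (auto simp: X_epowr)
      qed
      have F_eq: "F x = enn2real (X x) / w1 x" if "x \<in> \<Omega>" for x
      proof (cases "enn2real (X x) = 0")
        case True
        then show ?thesis by (simp add: F_def P_def)
      next
        case False
        then have Xr: "0 < enn2real (X x)" by (simp add: less_le)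
        have Px: "P x = enn2real (X x) powr p1 x" "0 < P x" using that Xr by (auto simp: P_def)
        have "1 / s1 x * (1 - a) = 1 / q1 x" using a by (simp add: s1_def)
        then have "((P x / v x) powr (1 / s1 x)) powr (1 - a) = (P x / v x) powr (1 / q1 x)" by (simp only: powr_powr)
        also have "\<dots> = P x powr (1 / q1 x) / w1 x"
          using Px v_pos[of x] w1_pos[of x] q1_pos[of x] by (simp add: powr_divide v_def powr_powr)
        finally have "F x = P x powr (1 / q1 x + a) / w1 x" by (simp add: F_def powr_add)
        also have "1 / q1 x + a = 1 / p1 x" by (simp add: inv_q1)
        also have "P x powr (1 / p1 x) = enn2real (X x)" using Px Xr p1_gt[of x] by (simp add: powr_powr)
        finally show ?thesis .
      qed
      have f_eq: "AE y in \<mu>. e2ennreal \<bar>f y\<bar> = ennreal t * ennreal (F y)"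
        using X_fin good_AE
      proof eventually_elim
        case (elim y)
        show ?case
        proof (cases "y \<in> \<Omega>")
          case True
          then have wy: "w y = ennreal (w1 y)" and Xy: "X y \<noteq> \<infinity>" using elim w_eq by auto
          obtain \<xi> where \<xi>: "f y = ereal \<xi>"
          proof (cases "f y")
            case PInf
            then have "X y = \<infinity>" using wy w1_pos[of y] t by (simp add: X_def enn2ereal_ennreal)
            then show ?thesis using Xy by simp
          next
            case MInf
            then have "X y = \<infinity>" using wy w1_pos[of y] t by (simp add: X_def enn2ereal_ennreal)
            then show ?thesis using Xy by simp
          qed (use that in auto)
          have "X y = ennreal (w1 y * \<bar>\<xi>\<bar> / t)"
            using wy \<xi> w1_pos[of y] t by (simp add: X_def enn2ereal_ennreal abs_mult e2ennreal_ereal)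
          then have "F y = \<bar>\<xi>\<bar> / t" using F_eq[OF True] w1_pos[of y] t by simp
          then show ?thesis using \<xi> t by (simp add: ennreal_mult[symmetric] e2ennreal_ereal)
        next
          case False
          then show ?thesis using f0 by (simp add: F_def P_def zero_ennreal.abs_eq[symmetric])
        qed
      qed
      define M where "M x = (SUP \<rho>\<in>{0<..}. (\<integral>\<^sup>+y\<in>cube x \<rho>. ennreal (F y) \<partial>\<mu>) / (emeasure \<mu> (cube x \<rho>)) epowr (1 - a))" for x
      have Fm[measurable]: "F \<in> borel_measurable \<mu>" unfolding F_def[abs_def] by measurable
      have frac: "frac_maximal \<mu> \<beta> \<alpha> f x = ennreal t * M x" for x
      proof -
        have "(\<integral>\<^sup>+y\<in>cube x \<rho>. e2ennreal \<bar>f y\<bar> \<partial>\<mu>) = ennreal t * (\<integral>\<^sup>+y\<in>cube x \<rho>. ennreal (F y) \<partial>\<mu>)" for \<rho>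
        proof -
          have "(\<integral>\<^sup>+y\<in>cube x \<rho>. e2ennreal \<bar>f y\<bar> \<partial>\<mu>) = (\<integral>\<^sup>+y. ennreal t * (ennreal (F y) * indicator (cube x \<rho>) y) \<partial>\<mu>)"
            by (rule nn_integral_cong_AE) (use f_eq in eventually_elim, simp add: mult.assoc)
          also have "\<dots> = ennreal t * (\<integral>\<^sup>+y\<in>cube x \<rho>. ennreal (F y) \<partial>\<mu>)" by (rule nn_integral_cmult) measurable
          finally show ?thesis .
        qed
        then show ?thesis
          unfolding frac_maximal_def M_def a_def by (simp add: SUP_mult_left_ennreal ennreal_times_divide)
      qed
      define E' where "E' = {x\<in>?E. good x}"
      define \<phi> where "\<phi> x = (if x \<in> E' then ennreal (v x) * M x epowr (q1 x) else 0)" for x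
      have "(\<integral>\<^sup>+x. \<phi> x \<partial>\<mu>) \<le> ennreal C0"
      proof (rule bound[rule_format, of P F E'], intro conjI allI impI ballI)
        show "E' \<subseteq> \<Omega>" using E_sub by (auto simp: E'_def)
        fix x assume x: "x \<in> E'"
        show "r < s1 y" if "y \<in> \<Omega>" "dist x y < \<epsilon>" for y
        proof (rule ccontr)
          assume "\<not> r < s1 y"
          then have "y \<in> \<Omega> - superlevel \<Omega> s r" using that s_eq by (auto simp: superlevel_def)
          moreover have "x \<in> ball y \<epsilon>" using that by (simp add: dist_commute)
          ultimately show False using x by (auto simp: E'_def inner_superlevel_def)
        qed
        have "s1 x / (1 - a) = q1 x" using a by (simp add: s1_def)
        then show "\<phi> x \<le> ennreal (v x) *
          (SUP \<rho>\<in>{0<..}. (\<integral>\<^sup>+y\<in>cube x \<rho>. ennreal (F y) \<partial>\<mu>) / (emeasure \<mu> (cube x \<rho>)) epowr (1 - a)) epowr (s1 x / (1 - a))"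
          using x by (simp add: \<phi>_def M_def)
      qed (auto simp: P F_def \<phi>_def)
      then have \<phi>_int: "(\<integral>\<^sup>+x. \<phi> x \<partial>\<mu>) \<le> ennreal K" using K by (meson ennreal_leI order_trans)
      \<comment> \<open>As \<open>q \<ge> 1\<close> and \<open>K \<ge> 1\<close>, dividing the function by \<open>K\<close> divides the modular at least by \<open>K\<close>.\<close>
      have "modular \<mu> q ?E (\<lambda>x. enn2ereal (w x * frac_maximal \<mu> \<beta> \<alpha> f x) / ereal (K * t)) \<le> (\<integral>\<^sup>+x. ennreal (1 / K) * \<phi> x \<partial>\<mu>)"
        unfolding modular_def
      proof (rule nn_integral_mono_AE, use good_AE in eventually_elim)
        case (elim x)
        show ?case
        proof (cases "x \<in> ?E")
          case True
          then have x: "x \<in> \<Omega>" "good x" "x \<in> E'" using elim E_sub by (auto simp: E'_def)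
          have "e2ennreal \<bar>enn2ereal (w x * frac_maximal \<mu> \<beta> \<alpha> f x) / ereal (K * t)\<bar> = ennreal (1 / (K * t)) * (w x * frac_maximal \<mu> \<beta> \<alpha> f x)"
            using K t by (intro e2ennreal_abs_divide) simp
          also have "\<dots> = ennreal (w1 x / K) * M x"
            using K t w1_pos[of x] unfolding w_eq[OF x(1,2)] frac
            by (simp add: mult.assoc[symmetric] ennreal_mult[symmetric])
          finally have "e2ennreal \<bar>enn2ereal (w x * frac_maximal \<mu> \<beta> \<alpha> f x) / ereal (K * t)\<bar> epowr (q x) = ennreal ((w1 x / K) powr q1 x) * M x epowr (q1 x)"
            using K w1_pos[of x] q1_pos[of x] q_eq[OF x(1)] by (simp add: epowr_mult_ennreal)
          also have "\<dots> \<le> ennreal (1 / K * v x) * M x epowr (q1 x)"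
          proof (intro mult_right_mono ennreal_leI)
            have "K powr 1 \<le> K powr q1 x" using K q1_gt[of x] by (intro powr_mono) auto
            then have "v x / K powr q1 x \<le> v x / K" using K v_pos[of x] by (intro divide_left_mono) auto
            then show "(w1 x / K) powr q1 x \<le> 1 / K * v x" using K w1_pos[of x] by (simp add: powr_divide v_def)
          qed simp
          also have "ennreal (1 / K * v x) = ennreal (1 / K) * ennreal (v x)" using K v_pos[of x] by (intro ennreal_mult) auto
          also have "\<dots> * M x epowr (q1 x) = ennreal (1 / K) * \<phi> x" using x(3) by (simp add: \<phi>_def mult.assoc)
          finally show ?thesis using True by simp
        qed simp
      qed
      also have "\<dots> \<le> ennreal (1 / K) * (\<integral>\<^sup>+x. \<phi> x \<partial>\<mu>)" using K by (intro nn_integral_cmult_le) simp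
      also have "\<dots> \<le> ennreal (1 / K) * ennreal K" by (intro mult_left_mono \<phi>_int) simp
      also have "\<dots> = 1" using K by (simp add: ennreal_mult[symmetric])
      finally show ?thesis .
    qed
    show ?thesis
    proof (intro exI[of _ K] conjI allI impI)
      show "0 < K" using K by simp
      fix f :: "real ^ 'n \<Rightarrow> ereal"
      assume "(\<forall>x. x \<notin> \<Omega> \<longrightarrow> f x = 0) \<and> (\<lambda>x. enn2ereal (w x) * f x) \<in> Lp \<mu> p \<Omega>"
      then show "lux_norm \<mu> q ?E (\<lambda>x. enn2ereal (w x * frac_maximal \<mu> \<beta> \<alpha> f x))
          \<le> ennreal K * lux_norm \<mu> p \<Omega> (\<lambda>x. enn2ereal (w x) * f x)"
        using K by (intro lux_norm_le_mult main) auto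
    qed
  qed
qed

end
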